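(* For every prime power $q$ and every integer $k\ge 1$, the graph $H_{k,q}$ (defined in the context) is regular. Writing $\Delta_q$ for its degree, we have $$N_q:=|V(H_{k,q})|=\frac{[2k+1]_q!}{(q+1)^k},$$ $$\Delta_q\le K_q:=(q+1)^k\left((q+1)^k-1\right),$$ and $$\operatorname{diam} H_{k,q}=k.$$ Moreover, for fixed $k$, as $q\to\infty$ through prime powers, $$\Delta_q=(1+o(1))K_q \qquad\text{and}\qquad N_q=(1+o(1))\Delta_q^k.$$
   Context: For a prime power $q$, write $[j]_q:=1+q+\cdots+q^{j-1}$ and $[t]_q!:=\prod_{j=1}^t [j]_q$. Let $V$ be a $t$-dimensional vector space. A complete flag in $V$ is an increasing chain of subspaces $F=(0=F_0<F_1<\cdots<F_{t-1}<F_t=V)$ with $\dim F_i=i$. Write $$F_{\mathrm{odd}}:=(F_i)_{1\le i<t,\ i\text{ odd}},\qquad F_{\mathrm{even}}:=(F_i)_{1\le i<t,\ i\text{ even}}.$$ Let $\mathcal F(V)$ be the set of complete flags of $V$, and set $$\mathcal P_{\mathrm{odd}}(V):=\{F_{\mathrm{odd}}:F\in\mathcal F(V)\},\qquad \mathcal P_{\mathrm{even}}(V):=\{F_{\mathrm{even}}:F\in\mathcal F(V)\}.$$ An element of $\mathcal P_{\mathrm{odd}}(V)$ and an element of $\mathcal P_{\mathrm{even}}(V)$ are called compatible if their members, interleaved by rank (dimension), form a complete flag (together with $0$ and $V$). Definition of $H_{k,q}$: for $k\ge 1$ and a prime power $q$, let $t=2k+1$ and $V=\mathbb F_q^{t}$.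 The simple graph $H_{k,q}$ has vertex set $\mathcal P_{\mathrm{even}}(V)$, and two distinct vertices are adjacent if and only if there is a member of $\mathcal P_{\mathrm{odd}}(V)$ compatible with both of them. The diameter of a graph is the maximum graph distance between two of its vertices (infinite if the graph is disconnected). *)

theory Defs
  imports
    Complex_Main
    "HOL-Library.Landau_Symbols"
    "HOL-Number_Theory.Prime_Powers"
    "Graph_Theory.Graph_Theory"
    "Jordan_Normal_Form.Missing_VectorSpace"
begin

definition q_int :: "nat \<Rightarrow> nat \<Rightarrow> nat" where
  "q_int q j = (\<Sum>i<j. q ^ i)"

definition q_fact :: "nat \<Rightarrow> nat \<Rightarrow> nat" where
  "q_fact q t = (\<Prod>j=1..t. q_int q j)"

text \<open>
  Flags and partial flags are families of subspaces indexed by dimension.  They are taken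
  extensional on their index sets, so that equality of families is HOL equality.
\<close>

definition complete_flags ::
  "('a, 'm) ring_scheme \<Rightarrow> ('a, 'v, 'n) module_scheme \<Rightarrow> nat \<Rightarrow> (nat \<Rightarrow> 'v set) set" where
  "complete_flags K V t = {F \<in> extensional {0..t}.
     F 0 = {\<zero>\<^bsub>V\<^esub>} \<and> F t = carrier V \<and>
     (\<forall>i\<le>t. VectorSpace.subspace K (F i) V \<and>
            vectorspace.dim K (V\<lparr>carrier := F i\<rparr>) = i) \<and>
     (\<forall>i<t. F i \<subset> F (Suc i))}"

definition odd_ranks :: "nat \<Rightarrow> nat set" where
  "odd_ranks t = {i. 1 \<le> i \<and> i < t \<and> odd i}"

definition even_ranks :: "nat \<Rightarrow> nat set" where
  "even_ranks t = {i. 1 \<le> i \<and> i < t \<and> even i}"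

definition P_odd ::
  "('a, 'm) ring_scheme \<Rightarrow> ('a, 'v, 'n) module_scheme \<Rightarrow> nat \<Rightarrow> (nat \<Rightarrow> 'v set) set" where
  "P_odd K V t = (\<lambda>F. restrict F (odd_ranks t)) ` complete_flags K V t"

definition P_even ::
  "('a, 'm) ring_scheme \<Rightarrow> ('a, 'v, 'n) module_scheme \<Rightarrow> nat \<Rightarrow> (nat \<Rightarrow> 'v set) set" where
  "P_even K V t = (\<lambda>F. restrict F (even_ranks t)) ` complete_flags K V t"

definition interleave ::
  "('a, 'v, 'n) module_scheme \<Rightarrow> nat \<Rightarrow> (nat \<Rightarrow> 'v set) \<Rightarrow> (nat \<Rightarrow> 'v set) \<Rightarrow> (nat \<Rightarrow> 'v set)" where
  "interleave V t A B = (\<lambda>i\<in>{0..t}.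
     if i = 0 then {\<zero>\<^bsub>V\<^esub>} else if i = t then carrier V else if odd i then A i else B i)"

definition compatible ::
  "('a, 'm) ring_scheme \<Rightarrow> ('a, 'v, 'n) module_scheme \<Rightarrow> nat \<Rightarrow>
   (nat \<Rightarrow> 'v set) \<Rightarrow> (nat \<Rightarrow> 'v set) \<Rightarrow> bool" where
  "compatible K V t A B \<longleftrightarrow> interleave V t A B \<in> complete_flags K V t"

text \<open>
  Simple graphs are symmetric loop-free digraphs without parallel arcs (locale
  \<^locale>\<open>graph\<close>), so the degree of a vertex is its out-degree.
\<close>

definition regular_of_degree :: "('v, 'e) pre_digraph \<Rightarrow> nat \<Rightarrow> bool" where
  "regular_of_degree G d \<longleftrightarrow> (\<forall>v\<in>verts G. out_degree G v = d)"

text \<open>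
  With unit arc weights \<open>\<mu>\<close> is the least number of arcs of a walk from \<open>u\<close> to \<open>v\<close>, and
  \<open>\<infinity>\<close> if there is none.
\<close>

definition graph_dist :: "('v, 'e) pre_digraph \<Rightarrow> 'v \<Rightarrow> 'v \<Rightarrow> ereal" where
  "graph_dist G u v = wf_digraph.\<mu> G (\<lambda>_. 1) u v"

definition diam :: "('v, 'e) pre_digraph \<Rightarrow> ereal" where
  "diam G = (SUP u\<in>verts G. SUP v\<in>verts G. graph_dist G u v)"

abbreviation coord_space :: "('a, 'm) ring_scheme \<Rightarrow> nat \<Rightarrow> ('a, nat \<Rightarrow> 'a) module" where
  "coord_space K t \<equiv> LinearCombinations.ring.func_space K {..<t}"

definition H :: "nat \<Rightarrow> ('a, 'm) ring_scheme \<Rightarrow>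
    (nat \<Rightarrow> (nat \<Rightarrow> 'a) set, (nat \<Rightarrow> (nat \<Rightarrow> 'a) set) \<times> (nat \<Rightarrow> (nat \<Rightarrow> 'a) set)) pre_digraph" where
  "H k K = (let t = 2 * k + 1; V = coord_space K t in
     \<lparr> verts = P_even K V t,
       arcs = {(B, B'). B \<in> P_even K V t \<and> B' \<in> P_even K V t \<and> B \<noteq> B' \<and>
                 (\<exists>A\<in>P_odd K V t. compatible K V t A B \<and> compatible K V t A B')},
       tail = fst, head = snd \<rparr>)"

lemma graph_H:
  assumes "ring K" and "finite (carrier K)"
  shows "graph (H k K)"
proof -
  let ?t = "2 * k + 1"
  let ?V = "coord_space K ?t"
  have "finite (carrier ?V)"
    unfolding ring.func_space_def[OF assms(1)] using assms by (auto intro: finite_PiE)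
  moreover have "P_even K ?V ?t \<subseteq> even_ranks ?t \<rightarrow>\<^sub>E Pow (carrier ?V)"
  proof
    fix B assume "B \<in> P_even K ?V ?t"
    then obtain F where F: "F \<in> complete_flags K ?V ?t" and B: "B = restrict F (even_ranks ?t)"
      by (auto simp: P_even_def)
    have "F i \<subseteq> carrier ?V" if "i \<in> even_ranks ?t" for i
      using F that by (auto simp: complete_flags_def even_ranks_def VectorSpace.subspace_def
          dest!: spec[of _ i] submodule.subset)
    then show "B \<in> even_ranks ?t \<rightarrow>\<^sub>E Pow (carrier ?V)"
      unfolding B by auto
  qed
  moreover have "finite (even_ranks ?t)"
    unfolding even_ranks_def by simp
  ultimately have fin: "finite (P_even K ?V ?t)"
    by (meson finite_PiE finite_Pow_iff finite_subset)
  have arcs: "arcs (H k K) \<subseteq> P_even K ?V ?t \<times> P_even K ?V ?t"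
    by (auto simp: H_def Let_def)
  show ?thesis
  proof
    show "finite (arcs (H k K))"
      using arcs fin by (meson finite_SigmaI finite_subset)
    show "finite (verts (H k K))"
      using fin by (simp add: H_def Let_def)
  qed (auto simp: H_def Let_def symmetric_conv arc_to_ends_def)
qed

definition K_bound :: "nat \<Rightarrow> nat \<Rightarrow> real" where
  "K_bound k q = (real q + 1) ^ k * ((real q + 1) ^ k - 1)"

end

theory Submission
  imports Defs "HOL-Real_Asymp.Real_Asymp"
begin

text \<open>
  The argument uses very little about subspaces: any two of dimensions \<open>i\<close> and \<open>j\<close> in an \<open>n\<close>-space
  meet in dimension at least \<open>i + j - n\<close>, and adjoining a vector raises the dimension by one.  The locale
  \<open>subspace_system\<close> records this in terms of cardinalities.  A vertex is the even part of a
  complete flag, and two vertices are linked if they are the even parts of flags with the same odd part.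

  At ranks no two of which are consecutive, the members of a flag can be exchanged
  independently (\<open>card_residue\<close>), with \<open>q + 1\<close> choices each.  Hence an even part has \<open>(q + 1) ^ k\<close>
  completions, which gives the number of vertices.  For the degree, the linked vertices are sorted by the set
  \<open>D\<close> of even ranks at which they differ from the given vertex.  A double count (\<open>card_moved\<close>) finds
  \<open>(q + 1) ^ k * q ^ card D / (q + 1) ^ f\<close> of them, where \<open>f\<close> is the number of odd ranks without
  neighbour in \<open>D\<close>.  The sum over nonempty \<open>D\<close> does not depend on the vertex, so the graph is regular.
  Ignoring the denominators gives the upper bound for the degree.  The single term in which \<open>D\<close> consists of
  all \<open>k\<close> even ranks gives the lower bound \<open>(q + 1) ^ k * q ^ k\<close>, and the asymptotic claims follow, since
  the numbers in question are \<open>q ^ (2 * k)\<close> and \<open>q ^ (2 * k * k)\<close> up to a factor tending to 1.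

  For the diameter, observe that along an edge the member of rank \<open>i\<close> of the new vertex lies in the member of rank
  \<open>i + 2\<close> of the old one (\<open>linked_shift\<close>).  After fewer than \<open>k\<close> edges the plane of the end point
  therefore still lies in the hyperplane of the starting point, which fails for suitable pairs.
  For the upper bound, let \<open>G\<close> be a flag completing the target.  Changing a flag \<open>F\<close> alternately at its
  odd and at its even ranks, each time greedily towards \<open>G\<close>, acts on the numbers \<open>dim (F i \<inter> G j)\<close>, for
  each fixed \<open>j\<close>, as odd-even transposition sort acts on 0-1 sequences (\<open>greedy_choice\<close>).  It takes
  \<open>2 * k\<close> rounds, that is \<open>k\<close> edges, until the even part is that of \<open>G\<close> (\<open>sorted_to\<close>, \<open>linked_diameter_le\<close>).
\<close>

section \<open>Systems of subspaces\<close>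

text \<open>
  The subspaces of a finite vector space, seen only as a family of finite sets: \<open>null\<close> and \<open>V\<close> are the
  least and the greatest subspace, and \<open>X\<close> has dimension \<open>i\<close> if \<open>card X = q ^ i\<close>.  The last two
  assumptions are what linear algebra contributes. Adjoining one vector to a subspace raises the
  dimension by exactly one, and \<open>card_Int_ge\<close> is the bound \<open>dim X + dim Y \<le> n + dim (X \<inter> Y)\<close> in
  multiplicative form.
\<close>

locale subspace_system =
  fixes S :: "'p set set" and null V :: "'p set" and q n :: nat
  assumes q_ge_2: "2 \<le> q"
    and bot_in: "null \<in> S" and card_bot: "card null = 1" and bot_le: "X \<in> S \<Longrightarrow> null \<subseteq> X"
    and top_in: "V \<in> S" and fin_top: "finite V" and card_top: "card V = q ^ n"
    and le_top: "X \<in> S \<Longrightarrow> X \<subseteq> V"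
    and Int_in: "X \<in> S \<Longrightarrow> Y \<in> S \<Longrightarrow> X \<inter> Y \<in> S"
    and join_point: "X \<in> S \<Longrightarrow> Z \<in> S \<Longrightarrow> X \<subseteq> Z \<Longrightarrow> v \<in> Z \<Longrightarrow> v \<notin> X \<Longrightarrow>
      \<exists>Y\<in>S. insert v X \<subseteq> Y \<and> Y \<subseteq> Z \<and> card Y = q * card X"
    and card_Int_ge: "X \<in> S \<Longrightarrow> Y \<in> S \<Longrightarrow> card X * card Y \<le> card V * card (X \<inter> Y)"
begin

definition level :: "nat \<Rightarrow> 'p set set" where
  "level i = {X \<in> S. card X = q ^ i}"

definition rk :: "'p set \<Rightarrow> nat" where
  "rk X = (THE i. card X = q ^ i)"

lemma fin: "X \<in> S \<Longrightarrow> finite X"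
  using finite_subset[OF le_top fin_top] .

lemma finite_S: "finite S"
  by (rule finite_subset[of S "Pow V"]) (use le_top fin_top in auto)

lemma finite_level: "finite (level i)"
  using finite_S by (auto simp: level_def)

lemma level_in: "X \<in> level i \<Longrightarrow> X \<in> S"
  by (simp add: level_def)

lemma pow_inj: "q ^ i = q ^ j \<longleftrightarrow> i = j"
  using q_ge_2 by simp

lemma pow_le: "q ^ i \<le> q ^ j \<longleftrightarrow> i \<le> j"
  using q_ge_2 by simp

lemma rk_level: "X \<in> level i \<Longrightarrow> rk X = i"
  unfolding rk_def level_def by (auto simp: pow_inj)

lemma join_point_level:
  assumes "X \<in> level i" "Z \<in> S" "X \<subseteq> Z" "v \<in> Z" "v \<notin> X"
  obtains Y where "Y \<in> level (Suc i)" "X \<subseteq> Y" "v \<in> Y" "Y \<subseteq> Z"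
  using join_point[of X Z v] assms unfolding level_def by auto

text \<open>
  A largest subspace of \<open>X\<close> whose size is a power of \<open>q\<close> must be \<open>X\<close>, since otherwise a further point
  of \<open>X\<close> could be adjoined.
\<close>

lemma level_exists:
  assumes "X \<in> S"
  shows "\<exists>i. X \<in> level i"
proof -
  let ?P = "\<lambda>Y. (\<exists>j. Y \<in> level j) \<and> Y \<subseteq> X"
  have "?P null"
    using bot_in bot_le[OF assms] card_bot by (auto simp: level_def intro!: exI[of _ 0])
  then obtain Y where Y: "?P Y" and max: "\<And>Z. ?P Z \<Longrightarrow> card Z \<le> card Y"
    using ex_has_greatest_nat[of ?P null card "card X + 1"] card_mono[OF fin[OF assms]]
    by (metis less_Suc_eq_le Suc_eq_plus1)
  then obtain j where j: "Y \<in> level j" by blast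
  have "Y = X"
  proof (rule ccontr)
    assume "Y \<noteq> X"
    then obtain v where v: "v \<in> X" "v \<notin> Y" using Y by blast
    have "Y \<subseteq> X" using Y by blast
    obtain Z where Z: "Z \<in> level (Suc j)" "Z \<subseteq> X"
      using join_point_level[OF j assms \<open>Y \<subseteq> X\<close> v] by metis
    have "card Z \<le> card Y" using max Z by blast
    then show False using Z(1) j pow_le[of "Suc j" j] by (auto simp: level_def)
  qed
  then show ?thesis using j by blast
qed

lemma in_level_rk: "X \<in> S \<Longrightarrow> X \<in> level (rk X)"
  using level_exists rk_level by blast

lemma card_eq: "X \<in> S \<Longrightarrow> card X = q ^ rk X"
  using in_level_rk by (simp add: level_def)

lemma rk_mono: "X \<in> S \<Longrightarrow> Y \<in> S \<Longrightarrow> X \<subseteq> Y \<Longrightarrow> rk X \<le> rk Y"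
  using card_mono[OF fin, of Y X] by (simp add: card_eq pow_le)

lemma rk_eq: "X \<in> S \<Longrightarrow> Y \<in> S \<Longrightarrow> X \<subseteq> Y \<Longrightarrow> rk Y \<le> rk X \<Longrightarrow> X = Y"
  using card_subset_eq[OF fin, of Y X] rk_mono[of X Y] by (simp add: card_eq)

lemma rk_strict_mono: "X \<in> S \<Longrightarrow> Y \<in> S \<Longrightarrow> X \<subset> Y \<Longrightarrow> rk X < rk Y"
  using rk_eq[of X Y] by (cases "rk X < rk Y") auto

lemma level_antisym: "X \<in> level i \<Longrightarrow> Y \<in> level i \<Longrightarrow> X \<subseteq> Y \<Longrightarrow> X = Y"
  using rk_eq[of X Y] by (simp add: rk_level level_in)

lemma bot_level: "null \<in> level 0"
  using bot_in card_bot by (simp add: level_def)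

lemma top_level: "V \<in> level n"
  using top_in card_top by (simp add: level_def)

lemma level_0: "X \<in> level 0 \<Longrightarrow> X = null"
  using level_antisym[OF bot_level, of X] bot_le[of X] level_in[of X 0] by simp

lemma level_n: "X \<in> level n \<Longrightarrow> X = V"
  using level_antisym[OF _ top_level, of X] le_top[of X] level_in[of X n] by simp

lemma rk_Int_ge:
  assumes "X \<in> S" "Y \<in> S"
  shows "rk X + rk Y \<le> n + rk (X \<inter> Y)"
proof -
  have "q ^ (rk X + rk Y) \<le> q ^ (n + rk (X \<inter> Y))"
    using card_Int_ge[OF assms] assms
    by (simp add: card_eq[OF assms(1)] card_eq[OF assms(2)] card_eq[OF Int_in[OF assms]] card_top power_add)
  then show ?thesis by (simp add: pow_le)
qed

definition covers :: "'p set \<Rightarrow> 'p set \<Rightarrow> 'p set set" where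
  "covers X Z = {Y \<in> level (Suc (rk X)). X \<subseteq> Y \<and> Y \<subseteq> Z}"

text \<open>
  The subspaces one dimension above \<open>X\<close> partition the points of \<open>Z - X\<close>, because a point outside \<open>X\<close>
  lies in exactly one of them.  Each block has \<open>q ^ (a + 1) - q ^ a\<close> points, where \<open>a\<close> is the rank of \<open>X\<close>.
\<close>

lemma card_covers:
  assumes X: "X \<in> S" and Z: "Z \<in> S" and XZ: "X \<subseteq> Z"
  shows "card (covers X Z) = q_int q (rk Z - rk X)"
proof -
  let ?a = "rk X" and ?b = "rk Z"
  let ?M = "covers X Z"
  have finM: "finite ?M" using finite_level by (simp add: covers_def)
  have ZX: "Z - X = (\<Union>Y\<in>?M. Y - X)"
  proof
    show "Z - X \<subseteq> (\<Union>Y\<in>?M. Y - X)"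
    proof
      fix v assume v: "v \<in> Z - X"
      then have "v \<in> Z" "v \<notin> X" by auto
      then obtain Y where "Y \<in> level (Suc ?a)" "X \<subseteq> Y" "v \<in> Y" "Y \<subseteq> Z"
        using join_point_level[OF in_level_rk[OF X] Z XZ] by metis
      then show "v \<in> (\<Union>Y\<in>?M. Y - X)" using v by (auto simp: covers_def)
    qed
  qed (auto simp: covers_def)
  have uniq: "Y = Y'" if Y: "Y \<in> ?M" "Y' \<in> ?M" and v: "v \<in> Y - X" "v \<in> Y' - X" for Y Y' v
  proof -
    have L: "Y \<in> level (Suc ?a)" "Y' \<in> level (Suc ?a)" and sub: "X \<subseteq> Y" "X \<subseteq> Y'"
      using Y by (auto simp: covers_def)
    have "X \<subset> Y \<inter> Y'" using v sub by blast
    then have "?a < rk (Y \<inter> Y')" using rk_strict_mono X L Int_in level_in by simp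
    then have "Y \<inter> Y' = Y" "Y \<inter> Y' = Y'"
      using rk_eq[of "Y \<inter> Y'"] Int_in L by (simp_all add: level_in rk_level)
    then show ?thesis by simp
  qed
  have "card (Z - X) = (\<Sum>Y\<in>?M. card (Y - X))"
    unfolding ZX
  proof (rule card_UN_disjoint[OF finM])
    show "\<forall>Y\<in>?M. finite (Y - X)" using fin level_in by (auto simp: covers_def)
    show "\<forall>Y\<in>?M. \<forall>Y'\<in>?M. Y \<noteq> Y' \<longrightarrow> (Y - X) \<inter> (Y' - X) = {}"
      using uniq by blast
  qed
  also have "\<dots> = (\<Sum>Y\<in>?M. q ^ Suc ?a - q ^ ?a)"
    by (rule sum.cong) (use X fin in \<open>auto simp: covers_def card_Diff_subset level_def card_eq\<close>)
  also have "\<dots> = card ?M * (q ^ Suc ?a - q ^ ?a)" by simp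
  finally have *: "q ^ ?b - q ^ ?a = card ?M * (q ^ Suc ?a - q ^ ?a)"
    using card_Diff_subset[OF fin[OF X] XZ] by (simp only: card_eq[OF X] card_eq[OF Z])
  define d where "d = ?b - ?a"
  have b: "?b = ?a + d" using rk_mono[OF X Z XZ] by (simp add: d_def)
  have geo: "(q - 1) * q_int q d = q ^ d - 1"
  proof (induction d)
    case (Suc d)
    have "q ^ d \<ge> 1" using q_ge_2 by simp
    have "q ^ Suc d \<ge> q ^ d" using pow_le[of d "Suc d"] by linarith
    then show ?case using Suc \<open>q ^ d \<ge> 1\<close> by (simp add: q_int_def algebra_simps)
  qed (simp add: q_int_def)
  have "q ^ ?a * ((q - 1) * q_int q d) = q ^ ?a * ((q - 1) * card ?M)"
    using * unfolding b geo by (simp add: algebra_simps power_add diff_mult_distrib2)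
  then show ?thesis using q_ge_2 by (simp add: d_def)
qed

section \<open>Counting complete flags\<close>

definition flags :: "(nat \<Rightarrow> 'p set) set" where
  "flags = {F \<in> extensional {0..n}. F 0 = null \<and> F n = V \<and>
     (\<forall>i\<le>n. F i \<in> level i) \<and> (\<forall>i<n. F i \<subset> F (Suc i))}"

lemma flag_level: "F \<in> flags \<Longrightarrow> i \<le> n \<Longrightarrow> F i \<in> level i"
  by (simp add: flags_def)

lemma flag_in: "F \<in> flags \<Longrightarrow> i \<le> n \<Longrightarrow> F i \<in> S"
  using flag_level level_in by blast

lemma flag_rk: "F \<in> flags \<Longrightarrow> i \<le> n \<Longrightarrow> rk (F i) = i"
  using flag_level rk_level by blast

lemma flag_mono:
  assumes "F \<in> flags" "i \<le> j" "j \<le> n"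
  shows "F i \<subseteq> F j"
  using assms(2,3)
proof (induction j rule: dec_induct)
  case (step m)
  then have "F m \<subset> F (Suc m)" using assms(1) by (simp add: flags_def)
  then show ?case using step by auto
qed simp

lemma flag_ends: "F \<in> flags \<Longrightarrow> F 0 = null" "F \<in> flags \<Longrightarrow> F n = V"
  by (auto simp: flags_def)

lemma flagI:
  assumes "F \<in> extensional {0..n}" "\<And>i. i \<le> n \<Longrightarrow> F i \<in> level i"
    "\<And>i. i < n \<Longrightarrow> F i \<subseteq> F (Suc i)"
  shows "F \<in> flags"
proof -
  have "F i \<noteq> F (Suc i)" if "i < n" for i
    using assms(2)[of i] assms(2)[of "Suc i"] that by (auto dest!: rk_level)
  then show ?thesis using assms level_0[of "F 0"] level_n[of "F n"]
    by (auto simp: flags_def psubset_eq)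
qed

lemma finite_flags: "finite flags"
proof (rule finite_subset)
  show "flags \<subseteq> ({0..n} \<rightarrow>\<^sub>E S)"
    using flag_in by (auto simp: PiE_def flags_def level_def)
  show "finite ({0..n} \<rightarrow>\<^sub>E S)" using finite_S by (intro finite_PiE) auto
qed

text \<open>
  A flag is built upwards: a chain that ends in dimension \<open>m\<close> has \<open>[n - m]\<^sub>q\<close> continuations by \<open>card_covers\<close>.
\<close>

lemma card_flags: "card flags = q_fact q n"
proof -
  define C where "C m = {F \<in> extensional {0..m}. (\<forall>i\<le>m. F i \<in> level i) \<and> (\<forall>i<m. F i \<subseteq> F (Suc i))}" for m :: nat
  have C_flags: "C n = flags"
    by (auto simp: C_def intro!: flagI) (auto simp: flags_def)
  have finC: "finite (C m)" for m
  proof (rule finite_subset)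
    show "C m \<subseteq> ({0..m} \<rightarrow>\<^sub>E S)" using level_in by (auto simp: C_def PiE_def)
    show "finite ({0..m} \<rightarrow>\<^sub>E S)" using finite_S by (intro finite_PiE) auto
  qed
  have step: "card (C (Suc m)) = card (C m) * q_int q (n - m)" for m
  proof -
    have bij: "bij_betw (\<lambda>(F, Y). F(Suc m := Y)) (SIGMA F:C m. covers (F m) V) (C (Suc m))"
    proof (rule bij_betw_byWitness[where f' = "\<lambda>F. (F(Suc m := undefined), F (Suc m))"])
      show "\<forall>a\<in>SIGMA F:C m. covers (F m) V.
          (\<lambda>F. (F(Suc m := undefined), F (Suc m))) ((\<lambda>(F, Y). F(Suc m := Y)) a) = a"
        by (auto simp: C_def extensional_def fun_eq_iff)
      show "\<forall>F\<in>C (Suc m). (\<lambda>(F, Y). F(Suc m := Y)) ((\<lambda>F. (F(Suc m := undefined), F (Suc m))) F) = F"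
        by auto
      show "(\<lambda>(F, Y). F(Suc m := Y)) ` (SIGMA F:C m. covers (F m) V) \<subseteq> C (Suc m)"
      proof clarify
        fix F Y assume F: "F \<in> C m" and Y: "Y \<in> covers (F m) V"
        have "rk (F m) = m" using F by (auto simp: C_def rk_level)
        then show "F(Suc m := Y) \<in> C (Suc m)"
          using F Y unfolding C_def covers_def
          by (simp add: extensional_def le_Suc_eq less_Suc_eq)
      qed
      show "(\<lambda>F. (F(Suc m := undefined), F (Suc m))) ` C (Suc m) \<subseteq> (SIGMA F:C m. covers (F m) V)"
      proof clarify
        fix F assume F: "F \<in> C (Suc m)"
        then have L: "F m \<in> level m" "F (Suc m) \<in> level (Suc m)" by (auto simp: C_def)
        have "F(Suc m := undefined) \<in> C m"
          using F unfolding C_def by (simp add: extensional_def)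
        moreover have "F (Suc m) \<in> covers ((F(Suc m := undefined)) m) V"
          using F L(2) rk_level[OF L(1)] le_top[OF level_in[OF L(2)]]
          unfolding C_def covers_def by simp
        ultimately show "F(Suc m := undefined) \<in> C m \<and> F (Suc m) \<in> covers ((F(Suc m := undefined)) m) V" ..
      qed
    qed
    have "card (covers (F m) V) = q_int q (n - m)" if "F \<in> C m" for F
    proof -
      have "F m \<in> level m" using that by (simp add: C_def)
      then show ?thesis
        using card_covers[of "F m" V] top_in le_top by (simp add: level_in rk_level rk_level[OF top_level])
    qed
    then show ?thesis
      using bij_betw_same_card[OF bij] finC by (simp add: card_SigmaI finite_level covers_def)
  qed
  have "C 0 = {\<lambda>i\<in>{0}. null}"
  proof (intro equalityI subsetI)
    fix F assume "F \<in> C 0"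
    then have "F \<in> extensional {0}" "F 0 = null" using level_0[of "F 0"] by (auto simp: C_def)
    then show "F \<in> {\<lambda>i\<in>{0}. null}" by (auto simp: extensional_def restrict_def fun_eq_iff)
  qed (use bot_level in \<open>auto simp: C_def\<close>)
  then have "card (C m) = (\<Prod>i<m. q_int q (n - i))" for m
    by (induction m) (simp_all add: step)
  from this[of n] have "card flags = (\<Prod>i<n. q_int q (n - i))"
    by (simp only: C_flags)
  also have "\<dots> = (\<Prod>j=1..n. q_int q j)"
    by (rule prod.reindex_bij_witness[where i = "\<lambda>j. n - j" and j = "\<lambda>i. n - i"]) auto
  finally show ?thesis by (simp add: q_fact_def)
qed

lemma flags_nonempty: "flags \<noteq> {}"
proof -
  have "q_int q j > 0" if "j \<ge> 1" for j
    using that q_ge_2 by (auto simp: q_int_def intro!: sum_pos2[where i=0])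
  then have "q_fact q n > 0" by (auto simp: q_fact_def intro!: prod_pos)
  then show ?thesis using card_flags by auto
qed

section \<open>Flags that differ in pairwise non-adjacent ranks\<close>

text \<open>
  If no two ranks of \<open>I\<close> are consecutive, the members of a flag at the ranks in \<open>I\<close> can be exchanged
  independently of each other: each is constrained only by its two neighbours, which stay.
  Together with \<open>flag_member_in_covers\<close> this makes the flags that agree with \<open>F\<close> off \<open>I\<close> a Cartesian
  product, and all counts below are instances of \<open>card_residue\<close>.
\<close>

lemma override_flag:
  assumes F: "F \<in> flags" and I: "I \<subseteq> {1..<n}" "\<And>i. i \<in> I \<Longrightarrow> Suc i \<notin> I"
    and G: "\<And>i. i \<in> I \<Longrightarrow> G i \<in> covers (F (i - 1)) (F (Suc i))"
  shows "override_on F G I \<in> flags"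
proof (rule flagI)
  show "override_on F G I \<in> extensional {0..n}"
    using F I(1) by (force simp: flags_def extensional_def override_on_def)
  show "override_on F G I i \<in> level i" if "i \<le> n" for i
  proof (cases "i \<in> I")
    case True
    then have "i \<ge> 1" using I(1) by auto
    then show ?thesis using True G[OF True] flag_rk[OF F, of "i - 1"] that by (simp add: covers_def)
  qed (simp add: flag_level[OF F that])
  show "override_on F G I i \<subseteq> override_on F G I (Suc i)" if "i < n" for i
  proof (cases "i \<in> I")
    case True
    then show ?thesis using G[OF True] I(2) by (simp add: covers_def)
  next
    case False
    then show ?thesis
      using G[of "Suc i"] flag_mono[OF F, of i "Suc i"] that by (cases "Suc i \<in> I") (auto simp: covers_def)
  qed
qed

lemma flag_member_in_covers:
  assumes F: "F \<in> flags" and F': "F' \<in> flags" and i: "i \<in> I"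
    and I: "I \<subseteq> {1..<n}" "\<And>i. i \<in> I \<Longrightarrow> Suc i \<notin> I"
    and agree: "\<And>j. j \<notin> I \<Longrightarrow> F' j = F j"
  shows "F' i \<in> covers (F (i - 1)) (F (Suc i))"
proof -
  have i1: "1 \<le> i" "i < n" using i I(1) by auto
  then have "i - 1 \<notin> I" using I(2)[of "i - 1"] i by auto
  then have "F (i - 1) = F' (i - 1)" "F (Suc i) = F' (Suc i)" using agree I(2)[OF i] by auto
  moreover have "F' (i - 1) \<subseteq> F' i" "F' i \<subseteq> F' (Suc i)" using flag_mono[OF F'] i1 by auto
  ultimately show ?thesis
    using flag_rk[OF F', of "i - 1"] flag_level[OF F', of i] i1 by (simp add: covers_def)
qed

lemma card_residue:
  assumes F: "F \<in> flags" and I: "I \<subseteq> {1..<n}" "\<And>i. i \<in> I \<Longrightarrow> Suc i \<notin> I"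
    and T: "\<And>i. i \<in> I \<Longrightarrow> T i \<subseteq> covers (F (i - 1)) (F (Suc i))"
  shows "card {F' \<in> flags. (\<forall>j. j \<notin> I \<longrightarrow> F' j = F j) \<and> (\<forall>i\<in>I. F' i \<in> T i)} = (\<Prod>i\<in>I. card (T i))"
proof -
  let ?R = "{F' \<in> flags. (\<forall>j. j \<notin> I \<longrightarrow> F' j = F j) \<and> (\<forall>i\<in>I. F' i \<in> T i)}"
  have "bij_betw (\<lambda>F'. restrict F' I) ?R (PiE I T)"
  proof (rule bij_betw_byWitness[where f' = "\<lambda>G. override_on F G I"])
    show "\<forall>F'\<in>?R. override_on F (restrict F' I) I = F'"
      by (auto simp: override_on_def fun_eq_iff)
    show "\<forall>G\<in>PiE I T. restrict (override_on F G I) I = G"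
      by (auto simp: override_on_def fun_eq_iff PiE_def extensional_def)
    show "(\<lambda>F'. restrict F' I) ` ?R \<subseteq> PiE I T" by auto
    show "(\<lambda>G. override_on F G I) ` PiE I T \<subseteq> ?R"
    proof clarify
      fix G assume G: "G \<in> PiE I T"
      have "override_on F G I \<in> flags"
        by (rule override_flag[OF F I]) (use G T in auto)
      then show "override_on F G I \<in> flags \<and> (\<forall>j. j \<notin> I \<longrightarrow> override_on F G I j = F j) \<and>
          (\<forall>i\<in>I. override_on F G I i \<in> T i)"
        using G by auto
    qed
  qed
  then have "card ?R = card (PiE I T)" by (rule bij_betw_same_card)
  also have "\<dots> = (\<Prod>i\<in>I. card (T i))"
    using I(1) finite_subset by (intro card_PiE) auto
  finally show ?thesis .
qed

lemma card_flag_covers: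
  assumes "F \<in> flags" "1 \<le> i" "i < n"
  shows "card (covers (F (i - 1)) (F (Suc i))) = q + 1"
proof -
  have "card (covers (F (i - 1)) (F (Suc i))) = q_int q (Suc i - (i - 1))"
    using card_covers[of "F (i - 1)" "F (Suc i)"] flag_in[OF assms(1)] flag_mono[OF assms(1)]
      flag_rk[OF assms(1)] assms(2,3) by simp
  also have "Suc i - (i - 1) = Suc (Suc 0)" using assms by simp
  finally show ?thesis by (simp add: q_int_def)
qed

section \<open>Sorting one flag towards another\<close>

text \<open>
  The member \<open>Y\<close> between \<open>X\<close> and \<open>Z\<close> is chosen greedily with respect to the target flag \<open>G\<close>: it takes in
  a point of \<open>Z - X\<close> from the first \<open>G j\<close> that offers one.  From then on \<open>Y \<inter> G j\<close> is larger than
  \<open>X \<inter> G j\<close>, and before that \<open>Z \<inter> G j\<close> adds nothing to \<open>X \<inter> G j\<close>.  For fixed \<open>j\<close>, the increments of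
  \<open>i \<mapsto> dim (F i \<inter> G j)\<close> form a 0-1 sequence, and this choice is a comparator that moves the 1 forward.
\<close>

lemma greedy_choice:
  assumes X: "X \<in> level a" and Z: "Z \<in> level (Suc (Suc a))" and XZ: "X \<subseteq> Z" and G: "G \<in> flags"
  shows "\<exists>Y\<in>covers X Z. \<forall>j\<le>n. min (Suc (rk (X \<inter> G j))) (rk (Z \<inter> G j)) \<le> rk (Y \<inter> G j)"
proof -
  define m where "m = (LEAST j. \<not> Z \<inter> G j \<subseteq> X)"
  have "\<not> Z \<subseteq> X" using rk_mono[of Z X] X Z by (auto simp: level_in rk_level)
  then have n: "\<not> Z \<inter> G n \<subseteq> X" using le_top[OF level_in[OF Z]] by (auto simp: flag_ends[OF G])
  then have m: "\<not> Z \<inter> G m \<subseteq> X" "m \<le> n"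
    unfolding m_def by (rule LeastI, rule Least_le)
  then obtain v where v: "v \<in> Z" "v \<in> G m" "v \<notin> X" by blast
  obtain Y where Y: "Y \<in> level (Suc a)" "X \<subseteq> Y" "v \<in> Y" "Y \<subseteq> Z"
    by (rule join_point_level[OF X level_in[OF Z] XZ v(1,3)])
  have "Y \<in> covers X Z" using Y X by (simp add: covers_def rk_level)
  moreover have "min (Suc (rk (X \<inter> G j))) (rk (Z \<inter> G j)) \<le> rk (Y \<inter> G j)" if j: "j \<le> n" for j
  proof (cases "j < m")
    case True
    then have "Z \<inter> G j \<subseteq> Y \<inter> G j" using not_less_Least[of j "\<lambda>j. \<not> Z \<inter> G j \<subseteq> X"] Y(2) by (auto simp: m_def)
    then have "rk (Z \<inter> G j) \<le> rk (Y \<inter> G j)"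
      using rk_mono Int_in flag_in[OF G j] level_in Y(1) Z by simp
    then show ?thesis by simp
  next
    case False
    then have "v \<in> G j" using flag_mono[OF G, of m j] j v(2) by auto
    then have "X \<inter> G j \<subset> Y \<inter> G j" using v(3) Y by blast
    then have "rk (X \<inter> G j) < rk (Y \<inter> G j)"
      using rk_strict_mono Int_in flag_in[OF G j] level_in[OF Y(1)] level_in[OF X] by simp
    then show ?thesis by simp
  qed
  ultimately show ?thesis by blast
qed

lemma greedy_round:
  assumes F: "F \<in> flags" and G: "G \<in> flags" and I: "I \<subseteq> {1..<n}" "\<And>i. i \<in> I \<Longrightarrow> Suc i \<notin> I"
  shows "\<exists>F'\<in>flags. (\<forall>j. j \<notin> I \<longrightarrow> F' j = F j) \<and>
    (\<forall>i\<in>I. \<forall>j\<le>n. min (Suc (rk (F (i - 1) \<inter> G j))) (rk (F (Suc i) \<inter> G j)) \<le> rk (F' i \<inter> G j))"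
proof -
  have "\<exists>Y\<in>covers (F (i - 1)) (F (Suc i)).
      \<forall>j\<le>n. min (Suc (rk (F (i - 1) \<inter> G j))) (rk (F (Suc i) \<inter> G j)) \<le> rk (Y \<inter> G j)" if "i \<in> I" for i
  proof (rule greedy_choice[OF _ _ _ G])
    have i: "1 \<le> i" "i < n" using that I(1) by auto
    show "F (i - 1) \<in> level (i - 1)" using flag_level[OF F] i by simp
    show "F (Suc i) \<in> level (Suc (Suc (i - 1)))" using flag_level[OF F, of "Suc i"] i by simp
    show "F (i - 1) \<subseteq> F (Suc i)" using flag_mono[OF F] i by simp
  qed
  then obtain Y where Y: "\<And>i. i \<in> I \<Longrightarrow> Y i \<in> covers (F (i - 1)) (F (Suc i))"
      "\<And>i j. i \<in> I \<Longrightarrow> j \<le> n \<Longrightarrow> min (Suc (rk (F (i - 1) \<inter> G j))) (rk (F (Suc i) \<inter> G j)) \<le> rk (Y i \<inter> G j)"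
    by metis
  have "override_on F Y I \<in> flags" by (rule override_flag[OF F I Y(1)])
  then show ?thesis using Y(2) by (intro bexI[of _ "override_on F Y I"]) simp_all
qed

text \<open>
  The invariant of odd-even transposition sort after \<open>s\<close> rounds, for the ranks \<open>J\<close> treated in the last
  round.  Rounds act by \<open>a\<^sub>i := min (a\<^sub>i\<^sub>-\<^sub>1 + 1) a\<^sub>i\<^sub>+\<^sub>1\<close> on \<open>a\<^sub>i = dim (F i \<inter> G j)\<close>, and the invariant is the
  lower bound \<open>2 a\<^sub>i \<ge> min (2 i) (min (2 j) (s + i + j - n))\<close>, which this recursion reproduces with
  \<open>s + 1\<close> in place of \<open>s\<close>.  The first two terms come from the ends of the sequence, where
  \<open>a\<^sub>0 = 0\<close> and \<open>a\<^sub>n = j\<close>.  The bound is spelled out as a disjunction, in which no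
  difference of natural numbers can truncate.
\<close>

definition sorted_to :: "(nat \<Rightarrow> 'p set) \<Rightarrow> nat \<Rightarrow> nat set \<Rightarrow> (nat \<Rightarrow> 'p set) \<Rightarrow> bool" where
  "sorted_to G s J F \<longleftrightarrow>
     (\<forall>i\<in>J. \<forall>j\<le>n. i \<le> rk (F i \<inter> G j) \<or> j \<le> rk (F i \<inter> G j) \<or> s + i + j \<le> n + 2 * rk (F i \<inter> G j))"

text \<open>
  Two subspaces of dimensions \<open>i\<close> and \<open>j\<close> meet in dimension at least \<open>i + j - n\<close>; the invariant asks
  for half of that.
\<close>

lemma sorted_to_0:
  assumes F: "F \<in> flags" and G: "G \<in> flags" and J: "J \<subseteq> {..n}"
  shows "sorted_to G 0 J F"
  unfolding sorted_to_def
proof (intro ballI allI impI)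
  fix i j assume "i \<in> J" and j: "j \<le> n"
  then have "i \<le> n" using J by auto
  then have "i + j \<le> n + rk (F i \<inter> G j)"
    using rk_Int_ge[OF flag_in[OF F] flag_in[OF G j], of i] flag_rk[OF F] flag_rk[OF G j] by simp
  then show "i \<le> rk (F i \<inter> G j) \<or> j \<le> rk (F i \<inter> G j) \<or> 0 + i + j \<le> n + 2 * rk (F i \<inter> G j)" by linarith
qed

lemma sorted_to_ends:
  assumes F: "F \<in> flags" and G: "G \<in> flags" and J: "sorted_to G s J F"
  shows "sorted_to G s (J \<union> {0, n}) F"
proof -
  have "rk (F n \<inter> G j) = j" if "j \<le> n" for j
  proof -
    have "F n \<inter> G j = G j" using le_top[OF flag_in[OF G that]] flag_ends(2)[OF F] by blast
    then show ?thesis using flag_rk[OF G that] by simp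
  qed
  then have "sorted_to G s {0, n} F" by (simp add: sorted_to_def)
  then show ?thesis using J unfolding sorted_to_def by blast
qed

lemma sorted_to_Suc:
  assumes F: "F \<in> flags" and G: "G \<in> flags" and I: "I \<subseteq> {1..<n}" "\<And>i. i \<in> I \<Longrightarrow> Suc i \<notin> I"
    and J: "sorted_to G s J F" and near: "\<And>i. i \<in> I \<Longrightarrow> i - 1 \<in> J \<union> {0, n} \<and> Suc i \<in> J \<union> {0, n}"
  shows "\<exists>F'\<in>flags. (\<forall>j. j \<notin> I \<longrightarrow> F' j = F j) \<and> sorted_to G (Suc s) I F'"
proof -
  obtain F' where F': "F' \<in> flags" "\<And>j. j \<notin> I \<Longrightarrow> F' j = F j" and
    greedy: "\<And>i j. i \<in> I \<Longrightarrow> j \<le> n \<Longrightarrow>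
      min (Suc (rk (F (i - 1) \<inter> G j))) (rk (F (Suc i) \<inter> G j)) \<le> rk (F' i \<inter> G j)"
    using greedy_round[OF F G I] by blast
  have "sorted_to G (Suc s) I F'"
    unfolding sorted_to_def
  proof (intro ballI allI impI)
    fix i j assume i: "i \<in> I" and j: "j \<le> n"
    have bound: "a \<le> rk (F a \<inter> G j) \<or> j \<le> rk (F a \<inter> G j) \<or> s + a + j \<le> n + 2 * rk (F a \<inter> G j)"
      if "a \<in> J \<union> {0, n}" for a
      using sorted_to_ends[OF F G J] that j unfolding sorted_to_def by blast
    obtain a where a: "i = Suc a" using i I(1) by (cases i) auto
    have "Suc (rk (F a \<inter> G j)) \<le> rk (F' i \<inter> G j) \<or> rk (F (Suc i) \<inter> G j) \<le> rk (F' i \<inter> G j)"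
      using greedy[OF i j] by (simp add: a min_le_iff_disj)
    then show "i \<le> rk (F' i \<inter> G j) \<or> j \<le> rk (F' i \<inter> G j) \<or>
        Suc s + i + j \<le> n + 2 * rk (F' i \<inter> G j)"
    proof
      assume "Suc (rk (F a \<inter> G j)) \<le> rk (F' i \<inter> G j)"
      moreover have "a \<in> J \<union> {0, n}" using near[OF i] by (simp add: a)
      note bound[OF this]
      ultimately show ?thesis unfolding a by linarith
    next
      assume "rk (F (Suc i) \<inter> G j) \<le> rk (F' i \<inter> G j)"
      moreover have "Suc i \<in> J \<union> {0, n}" using near[OF i] by blast
      note bound[OF this]
      ultimately show ?thesis by linarith
    qed
  qed
  then show ?thesis using F' by blast
qed

text \<open>
  Going down from rank \<open>n\<close>, a flag whose member of rank \<open>m + 1\<close> contains \<open>v\<close> is changed at the single rank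
  \<open>m\<close> so that this member contains \<open>v\<close> as well.
\<close>

lemma flag_through_point:
  assumes "v \<in> V" "1 \<le> n"
  shows "\<exists>F\<in>flags. v \<in> F 1"
  using assms(2)
proof (induction rule: inc_induct)
  case base
  obtain F where "F \<in> flags" using flags_nonempty by blast
  then show ?case using assms(1) flag_ends(2) by blast
next
  case (step m)
  then obtain F where F: "F \<in> flags" "v \<in> F (Suc m)" by blast
  show ?case
  proof (cases "v \<in> F (m - 1)")
    case True
    then show ?thesis using F flag_mono[OF F(1), of "m - 1" m] step by auto
  next
    case False
    have "F (m - 1) \<in> level (m - 1)" "F (Suc m) \<in> S" "F (m - 1) \<subseteq> F (Suc m)"
      using F(1) flag_level[of F "m - 1"] flag_in[of F "Suc m"] flag_mono[of F "m - 1" "Suc m"] step by auto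
    then obtain Y where Y: "Y \<in> level (Suc (m - 1))" "F (m - 1) \<subseteq> Y" "v \<in> Y" "Y \<subseteq> F (Suc m)"
      using join_point_level[of "F (m - 1)" "m - 1" "F (Suc m)" v] F(2) False by metis
    have "override_on F (\<lambda>_. Y) {m} \<in> flags"
      by (rule override_flag) (use Y F(1) step flag_rk[OF F(1), of "m - 1"] in \<open>auto simp: covers_def\<close>)
    then show ?thesis using Y(3) by (intro bexI[of _ "override_on F (\<lambda>_. Y) {m}"]) auto
  qed
qed

end

section \<open>The degree as an explicit sum\<close>

text \<open>
  If two linked even flags differ exactly at the ranks in \<open>D\<close>, these are the odd ranks at which a common
  compatible odd flag still has a choice.
\<close>

definition free_ranks :: "nat \<Rightarrow> nat set \<Rightarrow> nat set" where
  "free_ranks t D = {i \<in> odd_ranks t. i - 1 \<notin> D \<and> Suc i \<notin> D}"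

text \<open>
  The summand for \<open>D\<close> is the number of neighbours of a vertex that differ from it exactly at the ranks in
  \<open>D\<close>; the division is exact (lemma \<open>card_moved\<close> below).
\<close>

definition H_degree :: "nat \<Rightarrow> nat \<Rightarrow> nat" where
  "H_degree k q = (\<Sum>D\<in>Pow (even_ranks (2 * k + 1)) - {{}}.
     (q + 1) ^ k * q ^ card D div (q + 1) ^ card (free_ranks (2 * k + 1) D))"

lemma even_ranks_eq: "even_ranks (Suc (2 * k)) = (\<lambda>i. 2 * i) ` {1..k}"
  by (auto simp: even_ranks_def elim!: evenE)

lemma odd_ranks_eq: "odd_ranks (Suc (2 * k)) = (\<lambda>i. 2 * i + 1) ` {..<k}"
  by (auto simp: odd_ranks_def elim!: oddE)

lemma card_even_ranks: "card (even_ranks (Suc (2 * k))) = k"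
  unfolding even_ranks_eq by (subst card_image) (auto simp: inj_on_def)

lemma card_odd_ranks: "card (odd_ranks (Suc (2 * k))) = k"
  unfolding odd_ranks_eq by (subst card_image) (auto simp: inj_on_def)

lemma finite_even_ranks: "finite (even_ranks t)"
  by (simp add: even_ranks_def)

text \<open>
  Estimating each divisor by 1 leaves a binomial expansion of \<open>(q + 1) ^ k\<close> without its constant term.
\<close>

lemma H_degree_le: "H_degree k q \<le> (q + 1) ^ k * ((q + 1) ^ k - 1)"
proof -
  let ?E = "even_ranks (2 * k + 1)"
  have "(\<Sum>D\<in>Pow ?E. q ^ card D) = (\<Sum>D\<in>Pow ?E. (\<Prod>i\<in>D. q) * (\<Prod>i\<in>?E - D. 1))"
    by simp
  also have "\<dots> = (\<Prod>i\<in>?E. q + 1)"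
    by (rule prod_add[symmetric, OF finite_even_ranks])
  finally have all: "(\<Sum>D\<in>Pow ?E. q ^ card D) = (q + 1) ^ k" by (simp add: card_even_ranks)
  have "H_degree k q \<le> (\<Sum>D\<in>Pow ?E - {{}}. (q + 1) ^ k * q ^ card D)"
    unfolding H_degree_def by (intro sum_mono div_le_dividend)
  also have "\<dots> = (q + 1) ^ k * (\<Sum>D\<in>Pow ?E - {{}}. q ^ card D)"
    by (simp add: sum_distrib_left)
  also have "(\<Sum>D\<in>Pow ?E - {{}}. q ^ card D) = (q + 1) ^ k - 1"
    by (subst sum_diff1_nat) (simp_all only: all, simp)
  finally show ?thesis .
qed

text \<open>
  The summand in which all even ranks change already has the full order of magnitude: then no odd rank is
  free and the divisor is 1.
\<close>

lemma H_degree_ge: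
  assumes "k \<ge> 1"
  shows "(q + 1) ^ k * q ^ k \<le> H_degree k q"
proof -
  let ?E = "even_ranks (2 * k + 1)"
  have "free_ranks (2 * k + 1) ?E = {}"
    by (auto simp: free_ranks_def odd_ranks_def even_ranks_def elim!: oddE)
  moreover have "?E \<in> Pow ?E - {{}}" using assms by (auto simp: even_ranks_eq)
  ultimately show ?thesis
    unfolding H_degree_def
    using member_le_sum[of ?E "Pow ?E - {{}}"
        "\<lambda>D. (q + 1) ^ k * q ^ card D div (q + 1) ^ card (free_ranks (2 * k + 1) D)"]
    by (simp add: card_even_ranks finite_even_ranks)
qed

section \<open>Even parts of flags and the number of neighbours\<close>

locale odd_subspace_system = subspace_system +
  fixes k :: nat
  assumes n_eq: "n = 2 * k + 1"
begin

abbreviation Ev where "Ev \<equiv> even_ranks n"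
abbreviation Od where "Od \<equiv> odd_ranks n"

lemma Ev_sub: "Ev \<subseteq> {1..<n}" and Od_sub: "Od \<subseteq> {1..<n}"
  by (auto simp: even_ranks_def odd_ranks_def)

lemma Ev_Suc: "i \<in> Ev \<Longrightarrow> Suc i \<notin> Ev" and Od_Suc: "i \<in> Od \<Longrightarrow> Suc i \<notin> Od"
  by (auto simp: even_ranks_def odd_ranks_def)

lemma Od_near: "i \<in> Od \<Longrightarrow> i - 1 \<in> Ev \<union> {0, n} \<and> Suc i \<in> Ev \<union> {0, n}"
  by (auto simp: even_ranks_def odd_ranks_def n_eq)

lemma Ev_near: "i \<in> Ev \<Longrightarrow> i - 1 \<in> Od \<union> {0, n} \<and> Suc i \<in> Od \<union> {0, n}"
  by (auto simp: even_ranks_def odd_ranks_def n_eq)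

lemma fin_Ev: "finite Ev" by (simp add: even_ranks_def)

lemma restrict_eq_iff: "restrict F I = restrict F' I \<longleftrightarrow> (\<forall>i\<in>I. F' i = F i)"
  by (metis restrict_ext restrict_apply')

text \<open>
  Two flags agree at the ranks 0 and \<open>n\<close> and beyond \<open>n\<close> anyway.  With the even and the odd ranks for
  \<open>I\<close> and \<open>J\<close>, in either order, this turns equality of even (odd) parts into agreement off the odd
  (even) ranks, the form in which \<open>card_residue\<close> applies.
\<close>

lemma flags_agree:
  assumes "F \<in> flags" "F' \<in> flags" "{1..<n} \<subseteq> I \<union> J" "I \<inter> J = {}" "I \<subseteq> {1..<n}" 
  shows "restrict F I = restrict F' I \<longleftrightarrow> (\<forall>j. j \<notin> J \<longrightarrow> F' j = F j)"
proof
  assume eq: "restrict F I = restrict F' I"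
  show "\<forall>j. j \<notin> J \<longrightarrow> F' j = F j"
  proof (intro allI impI)
    fix j assume j: "j \<notin> J"
    have "j \<in> I \<or> j \<notin> {1..<n}" using assms(3) j by blast
    then consider "j \<in> I" | "j = 0" | "j = n" | "j > n" by force
    then show "F' j = F j"
    proof cases
      case 1 then show ?thesis using eq by (simp add: restrict_eq_iff)
    next
      case 4 then show ?thesis using assms(1,2) by (simp add: flags_def extensional_def)
    qed (simp_all add: flag_ends[OF assms(1)] flag_ends[OF assms(2)])
  qed
qed (use assms in \<open>auto simp: restrict_eq_iff\<close>)

lemma ranks_split: "{1..<n} \<subseteq> Ev \<union> Od" "{1..<n} \<subseteq> Od \<union> Ev" "Ev \<inter> Od = {}" "Od \<inter> Ev = {}"
  by (auto simp: even_ranks_def odd_ranks_def)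

lemmas even_part_eq_iff = flags_agree[OF _ _ ranks_split(1,3) Ev_sub]
lemmas odd_part_eq_iff = flags_agree[OF _ _ ranks_split(2,4) Od_sub]

definition even_flags where "even_flags = (\<lambda>F. restrict F Ev) ` flags"

text \<open>
  Two even flags are compatible with a common odd flag iff they are the even parts of two complete flags with
  the same odd part.
\<close>

definition linked where
  "linked B B' \<longleftrightarrow> (\<exists>F\<in>flags. \<exists>F'\<in>flags. restrict F Ev = B \<and> restrict F' Ev = B' \<and>
     restrict F Od = restrict F' Od)"

lemma finite_even_flags: "finite even_flags"
  using finite_flags by (simp add: even_flags_def)

lemma card_completions:
  assumes "B \<in> even_flags"
  shows "card {F \<in> flags. restrict F Ev = B} = (q + 1) ^ k"
proof -
  obtain F where F: "F \<in> flags" "B = restrict F Ev" using assms by (auto simp: even_flags_def)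
  have "{F' \<in> flags. restrict F' Ev = B} =
      {F' \<in> flags. (\<forall>j. j \<notin> Od \<longrightarrow> F' j = F j) \<and> (\<forall>i\<in>Od. F' i \<in> covers (F (i - 1)) (F (Suc i)))}"
  proof (rule Collect_cong, rule conj_cong[OF refl])
    fix F' assume F': "F' \<in> flags"
    have "restrict F' Ev = B \<longleftrightarrow> (\<forall>j. j \<notin> Od \<longrightarrow> F' j = F j)"
      using even_part_eq_iff[OF F(1) F'] F(2) by metis
    moreover have "F' i \<in> covers (F (i - 1)) (F (Suc i))" if "\<forall>j. j \<notin> Od \<longrightarrow> F' j = F j" "i \<in> Od" for i
      using flag_member_in_covers[OF F(1) F' that(2) Od_sub Od_Suc] that(1) by blast
    ultimately show "restrict F' Ev = B \<longleftrightarrow> (\<forall>j. j \<notin> Od \<longrightarrow> F' j = F j) \<and>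
        (\<forall>i\<in>Od. F' i \<in> covers (F (i - 1)) (F (Suc i)))" by blast
  qed
  then have "card {F' \<in> flags. restrict F' Ev = B} = (\<Prod>i\<in>Od. card (covers (F (i - 1)) (F (Suc i))))"
    using card_residue[OF F(1) Od_sub Od_Suc, of "\<lambda>i. covers (F (i - 1)) (F (Suc i))"] by simp
  also have "\<dots> = (\<Prod>i\<in>Od. q + 1)"
    using Od_sub by (intro prod.cong card_flag_covers[OF F(1)]) auto
  finally show ?thesis by (simp add: n_eq card_odd_ranks)
qed

text \<open>
  Every even flag is completed by \<open>k\<close> independent choices among \<open>q + 1\<close> subspaces.
\<close>

lemma card_even_flags: "card even_flags * (q + 1) ^ k = q_fact q n"
proof -
  have "card flags = (\<Sum>F\<in>flags. 1)" by simp
  also have "\<dots> = (\<Sum>B\<in>even_flags. \<Sum>F\<in>{F \<in> flags. restrict F Ev = B}. 1)"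
    unfolding even_flags_def by (rule sum.image_gen[OF finite_flags])
  also have "\<dots> = (\<Sum>B\<in>even_flags. (q + 1) ^ k)"
    using card_completions by simp
  finally show ?thesis using card_flags by simp
qed

definition moved :: "(nat \<Rightarrow> 'a set) \<Rightarrow> (nat \<Rightarrow> 'a set) \<Rightarrow> nat set" where
  "moved B B' = {i \<in> Ev. B' i \<noteq> B i}"

lemma moved_restrict: "moved (restrict F Ev) (restrict F' Ev) = {i \<in> Ev. F' i \<noteq> F i}"
  by (auto simp: moved_def)

text \<open>
  An odd rank with two unchanged neighbours keeps all \<open>q + 1\<close> choices.  If the upper
  neighbour has changed, the common member must be the intersection of the two distinct upper neighbours;
  if the lower one has changed, it must be the least subspace containing the two distinct lower neighbours.
  In both cases only one choice is left.
\<close>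

lemma common_covers:
  assumes F: "F \<in> flags" and F': "F' \<in> flags" and i: "i \<in> Od" and odd: "restrict F Od = restrict F' Od"
    and D: "D = moved (restrict F Ev) (restrict F' Ev)"
  shows "card (covers (F (i - 1)) (F (Suc i)) \<inter> covers (F' (i - 1)) (F' (Suc i))) =
    (if i \<in> free_ranks n D then q + 1 else 1)" (is "card ?T = _")
proof -
  have i1: "1 \<le> i" "i < n" using i Od_sub by auto
  have same: "j \<notin> D \<Longrightarrow> F' j = F j" if "j \<in> Ev \<union> {0, n}" for j
    using that flag_ends[OF F] flag_ends[OF F'] by (auto simp: D moved_restrict)
  have diff: "F' j \<noteq> F j" "1 \<le> j" "j < n" if "j \<in> D" for j
    using that Ev_sub by (auto simp: D moved_restrict)
  have Fi: "F' i = F i" using odd i by (auto simp: restrict_eq_iff)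
  show ?thesis
  proof (cases "i \<in> free_ranks n D")
    case True
    then have "F' (i - 1) = F (i - 1)" "F' (Suc i) = F (Suc i)"
      using same Od_near[OF i] by (auto simp: free_ranks_def)
    then show ?thesis using True card_flag_covers[OF F i1] by simp
  next
    case False
    have "F i \<in> ?T"
      using flag_mono[OF F, of "i - 1" i] flag_mono[OF F, of i "Suc i"] flag_mono[OF F', of "i - 1" i]
        flag_mono[OF F', of i "Suc i"] flag_rk[OF F, of "i - 1"] flag_rk[OF F', of "i - 1"]
        flag_level[OF F, of i] i1 Fi by (simp add: covers_def)
    moreover have "Y = F i" if Y: "Y \<in> ?T" for Y
    proof -
      have YL: "Y \<in> level i" using Y flag_rk[OF F, of "i - 1"] i1 by (simp add: covers_def)
      have FL: "F i \<in> level i" using flag_level[OF F] i1 by simp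
      from False i have "i - 1 \<in> D \<or> Suc i \<in> D" by (simp add: free_ranks_def)
      then show ?thesis
      proof
        assume low: "i - 1 \<in> D"
        have sub: "F (i - 1) \<subseteq> Y \<inter> F i" "F' (i - 1) \<subseteq> Y \<inter> F i"
          using Y \<open>F i \<in> ?T\<close> by (auto simp: covers_def)
        have L: "F (i - 1) \<in> level (i - 1)" "F' (i - 1) \<in> level (i - 1)"
          using flag_level[OF F] flag_level[OF F'] i1 by auto
        have "F (i - 1) \<noteq> Y \<inter> F i"
          using level_antisym[OF L(2,1)] sub(2) diff(1)[OF low] by auto
        then have "i - 1 < rk (Y \<inter> F i)"
          using rk_strict_mono[of "F (i - 1)" "Y \<inter> F i"] L(1) sub(1) Int_in[OF level_in[OF YL] level_in[OF FL]]
          by (auto simp: level_in rk_level)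
        then have "Y \<inter> F i = Y" "Y \<inter> F i = F i"
          using rk_eq[of "Y \<inter> F i"] Int_in[OF level_in[OF YL] level_in[OF FL]] YL FL
          by (simp_all add: level_in rk_level)
        then show ?thesis by simp
      next
        assume up: "Suc i \<in> D"
        let ?W = "F (Suc i) \<inter> F' (Suc i)"
        have sub: "Y \<subseteq> ?W" "F i \<subseteq> ?W" using Y \<open>F i \<in> ?T\<close> by (auto simp: covers_def)
        have L: "F (Suc i) \<in> level (Suc i)" "F' (Suc i) \<in> level (Suc i)"
          using flag_level[OF F] flag_level[OF F'] i1 by auto
        have W: "?W \<in> S" using Int_in L level_in by blast
        have "?W \<noteq> F (Suc i)"
          using level_antisym[OF L] diff(1)[OF up] by auto
        then have "rk ?W < Suc i"
          using rk_strict_mono[OF W level_in[OF L(1)]] L(1) by (auto simp: rk_level)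
        then have "Y = ?W" "F i = ?W"
          using rk_eq[OF _ W] sub YL FL by (simp_all add: level_in rk_level)
        then show ?thesis by simp
      qed
    qed
    ultimately have "?T = {F i}" by blast
    then show ?thesis using False by simp
  qed
qed

text \<open>
  Double counting of the pairs \<open>(F, F')\<close> of flags with the same odd part, where \<open>F\<close> completes \<open>B\<close> and the
  even parts differ exactly at \<open>D\<close>.  There are \<open>(q + 1) ^ k\<close> choices for \<open>F\<close>, and then \<open>q\<close> choices for \<open>F'\<close> at
  each rank of \<open>D\<close>.  On the other hand, by \<open>common_covers\<close>, every even flag \<open>B'\<close> that occurs comes from
  \<open>q + 1\<close> choices at each free odd rank.
\<close>

lemma card_moved:
  assumes B: "B \<in> even_flags" and D: "D \<subseteq> Ev"
  shows "card {B' \<in> even_flags. linked B B' \<and> moved B B' = D} * (q + 1) ^ card (free_ranks n D) =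
    (q + 1) ^ k * q ^ card D"
proof -
  define C where "C = {F \<in> flags. restrict F Ev = B}"
  define M where "M F = {F' \<in> flags. restrict F' Od = restrict F Od \<and> moved B (restrict F' Ev) = D}" for F
  define N where "N = {B' \<in> even_flags. linked B B' \<and> moved B B' = D}"
  have finC: "finite C" and finM: "finite (M F)" for F using finite_flags by (auto simp: C_def M_def)
  have card_M: "card (M F) = q ^ card D" if "F \<in> C" for F
  proof -
    have F: "F \<in> flags" "B = restrict F Ev" using that by (auto simp: C_def)
    have D1: "D \<subseteq> {1..<n}" "\<And>i. i \<in> D \<Longrightarrow> Suc i \<notin> D" using D Ev_sub Ev_Suc by blast+
    have "M F = {F' \<in> flags. (\<forall>j. j \<notin> D \<longrightarrow> F' j = F j) \<and>
        (\<forall>i\<in>D. F' i \<in> covers (F (i - 1)) (F (Suc i)) - {F i})}" (is "_ = ?R")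
    proof (intro equalityI subsetI)
      fix F' assume F': "F' \<in> M F"
      then have fl: "F' \<in> flags" and off: "\<And>j. j \<notin> Ev \<Longrightarrow> F' j = F j"
        using odd_part_eq_iff[OF F(1), of F'] by (auto simp: M_def)
      have DD: "D = {i \<in> Ev. F' i \<noteq> F i}" using F' by (simp add: M_def F(2) moved_restrict)
      have offD: "F' j = F j" if "j \<notin> D" for j using that off[of j] DD by blast
      have "F' i \<in> covers (F (i - 1)) (F (Suc i)) - {F i}" if "i \<in> D" for i
        using flag_member_in_covers[OF F(1) fl that D1 offD] that DD by simp
      then show "F' \<in> ?R" using fl offD by simp
    next
      fix F' assume F': "F' \<in> ?R"
      then have "restrict F' Od = restrict F Od"
        using odd_part_eq_iff[OF F(1), of F'] D by auto
      moreover have "moved B (restrict F' Ev) = D"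
        using F' D by (auto simp: F(2) moved_restrict)
      ultimately show "F' \<in> M F" using F' by (simp add: M_def)
    qed
    then have "card (M F) = (\<Prod>i\<in>D. card (covers (F (i - 1)) (F (Suc i)) - {F i}))"
      using card_residue[OF F(1) D1, of "\<lambda>i. covers (F (i - 1)) (F (Suc i)) - {F i}"] by auto
    also have "\<dots> = (\<Prod>i\<in>D. q)"
    proof (rule prod.cong[OF refl])
      fix i assume "i \<in> D"
      then have i: "1 \<le> i" "i < n" using D1(1) by auto
      have "F i \<in> covers (F (i - 1)) (F (Suc i))"
        using flag_member_in_covers[OF F(1) F(1) \<open>i \<in> D\<close> D1] by blast
      then show "card (covers (F (i - 1)) (F (Suc i)) - {F i}) = q"
        using card_flag_covers[OF F(1) i] by (simp add: card_Diff_singleton)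
    qed
    finally show ?thesis by simp
  qed
  have fibre: "card {p \<in> Sigma C M. restrict (snd p) Ev = B'} = (q + 1) ^ card (free_ranks n D)"
    if inN: "B' \<in> N" for B'
  proof -
    obtain F F' where FF: "F \<in> flags" "F' \<in> flags" "restrict F Ev = B" "restrict F' Ev = B'"
        "restrict F Od = restrict F' Od" and B': "moved B B' = D"
      using inN unfolding N_def linked_def by blast
    let ?T = "\<lambda>i. covers (F (i - 1)) (F (Suc i)) \<inter> covers (F' (i - 1)) (F' (Suc i))"
    let ?R = "{A \<in> flags. (\<forall>j. j \<notin> Od \<longrightarrow> A j = F j) \<and> (\<forall>i\<in>Od. A i \<in> ?T i)}"
    let ?P = "{p \<in> Sigma C M. restrict (snd p) Ev = B'}"
    \<comment> \<open>The first flag determines the pair, since the even part of the second is \<open>B'\<close> and the odd parts agree.\<close>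
    have "bij_betw fst ?P ?R"
    proof (rule bij_betw_byWitness[where f' = "\<lambda>A. (A, override_on F' A Od)"])
      show "\<forall>p\<in>?P. (\<lambda>A. (A, override_on F' A Od)) (fst p) = p"
      proof clarsimp
        fix A A' assume "A \<in> C" "A' \<in> M A" "B' = restrict A' Ev"
        then have "\<forall>j. j \<notin> Od \<longrightarrow> A' j = F' j" "\<forall>i\<in>Od. A' i = A i"
          using even_part_eq_iff[OF FF(2), of A'] FF(4) by (auto simp: M_def restrict_eq_iff)
        then show "override_on F' A Od = A'" by (auto simp: override_on_def fun_eq_iff)
      qed
      show "\<forall>A\<in>?R. fst (A, override_on F' A Od) = A" by simp
      show "fst ` ?P \<subseteq> ?R"
      proof clarsimp
        fix A A' assume A: "A \<in> C" "A' \<in> M A" "B' = restrict A' Ev"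
        have 1: "A \<in> flags" "\<And>j. j \<notin> Od \<Longrightarrow> A j = F j"
          using even_part_eq_iff[OF FF(1), of A] FF(3) A by (auto simp: C_def)
        have 2: "A' \<in> flags" "\<And>j. j \<notin> Od \<Longrightarrow> A' j = F' j"
          using even_part_eq_iff[OF FF(2), of A'] FF(4) A by (auto simp: M_def)
        have "A i = A' i" if "i \<in> Od" for i using A(2) that by (auto simp: M_def restrict_eq_iff)
        then have "A i \<in> ?T i" if "i \<in> Od" for i
          using flag_member_in_covers[OF FF(1) 1(1) that Od_sub Od_Suc 1(2)]
            flag_member_in_covers[OF FF(2) 2(1) that Od_sub Od_Suc 2(2)] that by simp
        then show "A \<in> flags \<and> (\<forall>j. j \<notin> Od \<longrightarrow> A j = F j) \<and>
            (\<forall>i\<in>Od. A i \<in> covers (F (i - Suc 0)) (F (Suc i)) \<and> A i \<in> covers (F' (i - Suc 0)) (F' (Suc i)))"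
          using 1 by simp
      qed
      show "(\<lambda>A. (A, override_on F' A Od)) ` ?R \<subseteq> ?P"
      proof (rule image_subsetI)
        fix A assume A: "A \<in> ?R"
        let ?A = "override_on F' A Od"
        have fl: "?A \<in> flags"
          by (rule override_flag[OF FF(2) Od_sub Od_Suc]) (use A in auto)
        have "A \<in> C" using A even_part_eq_iff[OF FF(1), of A] FF(3) by (auto simp: C_def)
        moreover have ev: "restrict ?A Ev = B'"
          using even_part_eq_iff[OF FF(2) fl] FF(4) by simp
        moreover have "restrict ?A Od = restrict A Od" by (simp add: restrict_eq_iff)
        then have "?A \<in> M A" using fl B' ev by (simp add: M_def)
        ultimately show "(A, ?A) \<in> ?P" by simp
      qed
    qed
    then have "card ?P = card ?R" by (rule bij_betw_same_card)
    also have "\<dots> = (\<Prod>i\<in>Od. card (?T i))"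
      by (rule card_residue[OF FF(1) Od_sub Od_Suc]) auto
    also have "\<dots> = (\<Prod>i\<in>Od. if i \<in> free_ranks n D then q + 1 else 1)"
      using common_covers[OF FF(1,2) _ FF(5) B'[symmetric, folded FF(3,4)]] by (intro prod.cong) auto
    also have "\<dots> = (\<Prod>i\<in>{i \<in> Od. i \<in> free_ranks n D}. q + 1)"
      by (rule prod.inter_filter[symmetric]) (simp add: odd_ranks_def)
    also have "{i \<in> Od. i \<in> free_ranks n D} = free_ranks n D" by (auto simp: free_ranks_def)
    finally show ?thesis by (simp only: prod_constant)
  qed
  have image: "(\<lambda>p. restrict (snd p) Ev) ` Sigma C M = N"
  proof (intro equalityI subsetI)
    fix B' assume "B' \<in> (\<lambda>p. restrict (snd p) Ev) ` Sigma C M"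
    then obtain F F' where "F \<in> C" "F' \<in> M F" "B' = restrict F' Ev" by auto
    then have "F \<in> flags" "F' \<in> flags" "restrict F Ev = B" "restrict F' Ev = B'"
      "restrict F Od = restrict F' Od" "moved B B' = D" by (simp_all add: C_def M_def)
    then show "B' \<in> N" unfolding N_def linked_def even_flags_def by blast
  next
    fix B' assume "B' \<in> N"
    then obtain F F' where FF: "F \<in> flags" "F' \<in> flags" "restrict F Ev = B" "restrict F' Ev = B'"
        "restrict F Od = restrict F' Od" and B': "moved B B' = D"
      unfolding N_def linked_def by blast
    then have "(F, F') \<in> Sigma C M" by (auto simp: C_def M_def)
    then show "B' \<in> (\<lambda>p. restrict (snd p) Ev) ` Sigma C M" using FF(4) by force
  qed
  have "card C * q ^ card D = card (Sigma C M)"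
    using finC finM card_M by (simp add: card_SigmaI)
  also have "\<dots> = (\<Sum>p\<in>Sigma C M. 1)" by simp
  also have "\<dots> = (\<Sum>B'\<in>N. \<Sum>p\<in>{p \<in> Sigma C M. restrict (snd p) Ev = B'}. 1)"
    unfolding image[symmetric] by (rule sum.image_gen) (use finC finM in auto)
  also have "\<dots> = card N * (q + 1) ^ card (free_ranks n D)"
    using fibre by simp
  finally show ?thesis using card_completions[OF B] by (simp add: N_def C_def)
qed

lemma card_linked_neighbours:
  assumes B: "B \<in> even_flags"
  shows "card {B' \<in> even_flags. linked B B' \<and> B' \<noteq> B} = H_degree k q"
proof -
  let ?N = "\<lambda>D. {B' \<in> even_flags. linked B B' \<and> moved B B' = D}"
  have neq: "B' \<noteq> B \<longleftrightarrow> moved B B' \<noteq> {}" if "B' \<in> even_flags" for B'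
  proof
    assume "B' \<noteq> B"
    then obtain i where i: "B' i \<noteq> B i" by (auto simp: fun_eq_iff)
    then have "i \<in> Ev" using B that by (auto simp: even_flags_def restrict_def split: if_splits)
    then show "moved B B' \<noteq> {}" using i by (auto simp: moved_def)
  qed (auto simp: moved_def)
  have "{B' \<in> even_flags. linked B B' \<and> B' \<noteq> B} = (\<Union>D\<in>Pow Ev - {{}}. ?N D)"
    using neq by (auto simp: moved_def)
  then have "card {B' \<in> even_flags. linked B B' \<and> B' \<noteq> B} = (\<Sum>D\<in>Pow Ev - {{}}. card (?N D))"
    using finite_even_flags fin_Ev by (simp add: card_UN_disjoint disjoint_iff)
  also have "\<dots> = (\<Sum>D\<in>Pow Ev - {{}}. (q + 1) ^ k * q ^ card D div (q + 1) ^ card (free_ranks n D))"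
  proof (rule sum.cong[OF refl])
    fix D assume "D \<in> Pow Ev - {{}}"
    then have "card (?N D) * (q + 1) ^ card (free_ranks n D) = (q + 1) ^ k * q ^ card D"
      using card_moved[OF B] by blast
    then show "card (?N D) = (q + 1) ^ k * q ^ card D div (q + 1) ^ card (free_ranks n D)"
      by (subst (asm) eq_commute) simp
  qed
  finally show ?thesis by (simp add: H_degree_def n_eq)
qed

section \<open>Distances between even flags\<close>

text \<open>
  One edge is worth two rounds of sorting: the first changes the odd part of \<open>F\<close> and leaves its even part,
  the second changes the even part and leaves the odd part.
\<close>

lemma linked_sweep:
  assumes F: "F \<in> flags" and G: "G \<in> flags" and s: "sorted_to G s Ev F"
  shows "\<exists>F'\<in>flags. linked (restrict F Ev) (restrict F' Ev) \<and> sorted_to G (Suc (Suc s)) Ev F'"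
proof -
  obtain A where A: "A \<in> flags" "\<forall>j. j \<notin> Od \<longrightarrow> A j = F j" "sorted_to G (Suc s) Od A"
    using sorted_to_Suc[OF F G Od_sub Od_Suc s Od_near] by blast
  obtain F' where F': "F' \<in> flags" "\<forall>j. j \<notin> Ev \<longrightarrow> F' j = A j" "sorted_to G (Suc (Suc s)) Ev F'"
    using sorted_to_Suc[OF A(1) G Ev_sub Ev_Suc A(3) Ev_near] by blast
  have "restrict F Ev = restrict A Ev" using even_part_eq_iff[OF F A(1)] A(2) by blast
  moreover have "restrict A Od = restrict F' Od" using odd_part_eq_iff[OF A(1) F'(1)] F'(2) by blast
  ultimately have "linked (restrict F Ev) (restrict F' Ev)" unfolding linked_def using A(1) F'(1) by metis
  then show ?thesis using F' by blast
qed

text \<open>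
  After \<open>2 k\<close> rounds, the invariant at \<open>i = j\<close> reads \<open>2 dim (F' i \<inter> G i) \<ge> 2 i - 1\<close>, which
  forces \<open>F' i = G i\<close>.
\<close>

lemma linked_diameter_le:
  assumes F: "F \<in> flags" and G: "G \<in> flags"
  shows "(linked ^^ k) (restrict F Ev) (restrict G Ev)"
proof -
  have "\<exists>F'\<in>flags. (linked ^^ m) (restrict F Ev) (restrict F' Ev) \<and> sorted_to G (2 * m) Ev F'" for m
  proof (induction m)
    case 0
    have "Ev \<subseteq> {..n}" using Ev_sub by auto
    then show ?case using sorted_to_0[OF F G] F by auto
  next
    case (Suc m)
    then obtain F' where F': "F' \<in> flags" "(linked ^^ m) (restrict F Ev) (restrict F' Ev)"
      "sorted_to G (2 * m) Ev F'" by blast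
    obtain F'' where F'': "F'' \<in> flags" "linked (restrict F' Ev) (restrict F'' Ev)"
      "sorted_to G (Suc (Suc (2 * m))) Ev F''"
      using linked_sweep[OF F'(1) G F'(3)] by blast
    have "(linked ^^ Suc m) (restrict F Ev) (restrict F'' Ev)"
      using F'(2) F''(2) by (intro relpowp_Suc_I)
    moreover have "sorted_to G (2 * Suc m) Ev F''" using F''(3) by simp
    ultimately show ?case using F''(1) by blast
  qed
  then obtain F' where F': "F' \<in> flags" "(linked ^^ k) (restrict F Ev) (restrict F' Ev)"
    and sorted: "sorted_to G (2 * k) Ev F'" by blast
  have "F' i = G i" if i: "i \<in> Ev" for i
  proof -
    have "i \<le> n" using i Ev_sub by auto
    then have "i \<le> rk (F' i \<inter> G i) \<or> 2 * k + i + i \<le> n + 2 * rk (F' i \<inter> G i)"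
      using sorted i unfolding sorted_to_def by blast
    then have "i \<le> rk (F' i \<inter> G i)" unfolding n_eq by linarith
    then have "F' i \<inter> G i = F' i" "F' i \<inter> G i = G i"
      using rk_eq[of "F' i \<inter> G i"] flag_in[OF F'(1) \<open>i \<le> n\<close>] flag_in[OF G \<open>i \<le> n\<close>]
        flag_rk[OF F'(1) \<open>i \<le> n\<close>] flag_rk[OF G \<open>i \<le> n\<close>] Int_in by simp_all
    then show ?thesis by simp
  qed
  then have "restrict F' Ev = restrict G Ev" by (simp add: restrict_eq_iff)
  then show ?thesis using F'(2) by simp
qed

text \<open>
  The common odd flag has a member of rank \<open>i + 1\<close> between the two.
\<close>

lemma linked_shift:
  assumes "linked B B'" "i \<in> Ev" "i + 2 \<in> Ev"
  shows "B' i \<subseteq> B (i + 2)"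
proof -
  obtain F F' where F: "F \<in> flags" "F' \<in> flags" "restrict F Ev = B" "restrict F' Ev = B'"
      "restrict F Od = restrict F' Od"
    using assms(1) unfolding linked_def by blast
  have i: "i + 2 < n" "i + 1 \<in> Od" using assms(2,3) by (auto simp: even_ranks_def odd_ranks_def)
  have "B' i = F' i" "B (i + 2) = F (i + 2)" using F(3,4) assms(2,3) by auto
  moreover have "F' (i + 1) = F (i + 1)" using F(5) i by (simp add: restrict_eq_iff)
  ultimately show ?thesis
    using flag_mono[OF F(2), of i "i + 1"] flag_mono[OF F(1), of "i + 1" "i + 2"] i by auto
qed

text \<open>
  By \<open>linked_shift\<close>, \<open>k - 1\<close> edges from \<open>B\<close> cannot lead to an even flag whose plane leaves the hyperplane
  \<open>B (2 * k)\<close>; this lemma provides such a plane.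
\<close>

lemma far_pair:
  assumes "k \<ge> 1"
  shows "\<exists>B\<in>even_flags. \<exists>B'\<in>even_flags. \<not> B' 2 \<subseteq> B (2 * k)"
proof -
  have n: "1 < n" "2 * k < n" "2 \<in> Ev" "2 * k \<in> Ev" using assms by (auto simp: n_eq even_ranks_def)
  obtain F where F: "F \<in> flags" using flags_nonempty by blast
  have "rk (F (2 * k)) \<noteq> rk V" using flag_rk[OF F] rk_level[OF top_level] n by simp
  then have "F (2 * k) \<noteq> V" by auto
  moreover have "F (2 * k) \<subseteq> V" using le_top[OF flag_in[OF F, of "2 * k"]] n by simp
  ultimately obtain v where v: "v \<in> V" "v \<notin> F (2 * k)" by blast
  obtain G where G: "G \<in> flags" "v \<in> G 1" using flag_through_point[OF v(1)] n by auto
  then have "v \<in> G 2" using flag_mono[OF G(1), of 1 2] n Ev_sub by auto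
  then have "\<not> restrict G Ev 2 \<subseteq> restrict F Ev (2 * k)" using v(2) n by auto
  then show ?thesis using F G unfolding even_flags_def by blast
qed

lemma linked_even_flags: "linked B B' \<Longrightarrow> B \<in> even_flags \<and> B' \<in> even_flags"
  unfolding even_flags_def linked_def by blast

text \<open>
  The graph of the theorem, written without the ambient field.  The pairs themselves serve as arcs, so that
  it can later be identified with the given graph by plain equality.
\<close>

definition linked_graph where
  "linked_graph = \<lparr>verts = even_flags, arcs = {(B, B'). linked B B' \<and> B \<noteq> B'}, tail = fst, head = snd\<rparr>"

lemma linked_graph_simps [simp]:
  "verts linked_graph = even_flags" "arcs linked_graph = {(B, B'). linked B B' \<and> B \<noteq> B'}"
  "tail linked_graph = fst" "head linked_graph = snd"
  by (simp_all add: linked_graph_def)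

sublocale linked_graph: wf_digraph linked_graph
  by unfold_locales (auto dest: linked_even_flags)

lemma regular_linked_graph: "regular_of_degree linked_graph (H_degree k q)"
  unfolding regular_of_degree_def
proof
  fix B assume "B \<in> verts linked_graph"
  then have B: "B \<in> even_flags" by simp
  have "out_arcs linked_graph B = Pair B ` {B' \<in> even_flags. linked B B' \<and> B' \<noteq> B}"
    using linked_even_flags by (auto simp: out_arcs_def)
  then have "out_degree linked_graph B = card {B' \<in> even_flags. linked B B' \<and> B' \<noteq> B}"
    by (simp add: out_degree_def card_image inj_on_def)
  then show "out_degree linked_graph B = H_degree k q" using card_linked_neighbours[OF B] by simp
qed

lemma awalk_cost_1: "linked_graph.awalk_cost (\<lambda>_. 1) p = real (length p)"
  by (induction p) simp_all

lemma linked_pow_awalk: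
  assumes "B \<in> even_flags" "(linked ^^ m) B B'"
  shows "\<exists>p. linked_graph.awalk B p B' \<and> length p \<le> m"
  using assms(2)
proof (induction m arbitrary: B')
  case 0
  then show ?case using assms(1)
    by (intro exI[of _ "[]"]) (simp add: linked_graph.awalk_Nil_iff)
next
  case (Suc m)
  then obtain C where C: "(linked ^^ m) B C" "linked C B'" by auto
  then obtain p where p: "linked_graph.awalk B p C" "length p \<le> m" using Suc.IH by blast
  show ?case
  proof (cases "C = B'")
    case True
    then show ?thesis using p by (auto intro: le_SucI)
  next
    case False
    then have "linked_graph.awalk C [(C, B')] B'"
      using C(2) linked_even_flags[OF C(2)]
      by (simp add: linked_graph.awalk_Cons_iff linked_graph.awalk_Nil_iff)
    then have "linked_graph.awalk B (p @ [(C, B')]) B'" by (rule linked_graph.awalk_appendI[OF p(1)])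
    then show ?thesis using p(2) by (intro exI[of _ "p @ [(C, B')]"]) simp
  qed
qed

lemma awalk_shift:
  assumes "linked_graph.awalk B p B'" "2 + 2 * length p \<le> 2 * k"
  shows "B' 2 \<subseteq> B (2 + 2 * length p)"
  using assms
proof (induction p arbitrary: B)
  case Nil
  then show ?case by (simp add: linked_graph.awalk_Nil_iff)
next
  case (Cons e p)
  obtain C where C: "e = (B, C)" "linked B C" "linked_graph.awalk C p B'"
    using Cons.prems(1) unfolding linked_graph.awalk_Cons_iff by (cases e) auto
  have "B' 2 \<subseteq> C (2 + 2 * length p)" using Cons.IH[OF C(3)] Cons.prems(2) by simp
  also have "\<dots> \<subseteq> B (2 + 2 * length p + 2)"
    using Cons.prems(2) by (intro linked_shift[OF C(2)]) (auto simp: even_ranks_def n_eq)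
  finally show ?case by (simp add: add.commute)
qed

lemma diam_linked_graph:
  assumes k: "k \<ge> 1"
  shows "diam linked_graph = ereal (real k)"
proof (rule antisym)
  show "diam linked_graph \<le> ereal (real k)"
    unfolding diam_def
  proof (intro SUP_least)
    fix B B' assume B: "B \<in> verts linked_graph" "B' \<in> verts linked_graph"
    then obtain p where p: "linked_graph.awalk B p B'" "length p \<le> k"
      using linked_diameter_le linked_pow_awalk[of B k B'] by (auto simp: even_flags_def)
    have "graph_dist linked_graph B B' \<le> ereal (linked_graph.awalk_cost (\<lambda>_. 1) p)"
      unfolding graph_dist_def by (rule linked_graph.min_cost_le_walk_cost[OF p(1)])
    also have "\<dots> \<le> ereal (real k)" using p(2) by (simp add: awalk_cost_1)
    finally show "graph_dist linked_graph B B' \<le> ereal (real k)" .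
  qed
next
  obtain B B' where B: "B \<in> even_flags" "B' \<in> even_flags" "\<not> B' 2 \<subseteq> B (2 * k)"
    using far_pair[OF k] by blast
  have "ereal (real k) \<le> graph_dist linked_graph B B'"
    unfolding graph_dist_def linked_graph.\<mu>_def
  proof (rule INF_greatest)
    fix p assume "p \<in> {p. linked_graph.awalk B p B'}"
    then have p: "linked_graph.awalk B p B'" by simp
    have "k \<le> length p"
    proof (rule ccontr)
      assume "\<not> k \<le> length p"
      then have le: "2 + 2 * length p \<le> 2 * k" by simp
      obtain F where F: "F \<in> flags" "B = restrict F Ev" using B(1) by (auto simp: even_flags_def)
      have "B' 2 \<subseteq> B (2 + 2 * length p)" by (rule awalk_shift[OF p le])
      also have "\<dots> \<subseteq> B (2 * k)"
        using flag_mono[OF F(1) le] le k by (simp add: F(2) even_ranks_def n_eq)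
      finally show False using B(3) by simp
    qed
    then show "ereal (real k) \<le> ereal (linked_graph.awalk_cost (\<lambda>_. 1) p)" by (simp add: awalk_cost_1)
  qed
  also have "\<dots> \<le> diam linked_graph"
    unfolding diam_def by (intro SUP_upper2[of B] SUP_upper) (simp_all add: B)
  finally show "ereal (real k) \<le> diam linked_graph" .
qed

end

section \<open>Subspaces of a finite vector space\<close>

context vectorspace
begin

text \<open>
  Coordinates with respect to a basis identify \<open>V\<close> with the coefficient functions.
\<close>

lemma card_eq_dim:
  assumes "finite (carrier K)" "finite (carrier V)"
  shows "card (carrier V) = card (carrier K) ^ dim"
proof -
  have "span (carrier V) = carrier V"
    using in_own_span[of "carrier V"] span_is_subset2[of "carrier V"] by blast
  then have "fin_dim" unfolding fin_dim_def using assms(2) by blast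
  then obtain A where A: "finite A" "basis A" using finite_basis_exists by blast
  then have AV: "A \<subseteq> carrier V" by (simp add: basis_def)
  have "bij_betw (\<lambda>a. lincomb a A) (A \<rightarrow>\<^sub>E carrier K) (carrier V)"
    unfolding bij_betw_def
  proof
    have uniq: "\<exists>!a. a \<in> A \<rightarrow>\<^sub>E carrier K \<and> lincomb a A = v" if "v \<in> carrier V" for v
      using basis_criterion[OF A(1) AV] A(2) that by blast
    have closed: "lincomb a A \<in> carrier V" if "a \<in> A \<rightarrow>\<^sub>E carrier K" for a
      using that AV by (intro lincomb_closed) auto
    show "inj_on (\<lambda>a. lincomb a A) (A \<rightarrow>\<^sub>E carrier K)"
    proof (rule inj_onI)
      fix a b assume a: "a \<in> A \<rightarrow>\<^sub>E carrier K" and b: "b \<in> A \<rightarrow>\<^sub>E carrier K" and "lincomb a A = lincomb b A"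
      then show "a = b" using uniq[OF closed[OF a]] by metis
    qed
    show "(\<lambda>a. lincomb a A) ` (A \<rightarrow>\<^sub>E carrier K) = carrier V"
      using uniq closed by (auto simp: image_iff) metis
  qed
  then have "card (carrier V) = card (A \<rightarrow>\<^sub>E carrier K)" by (simp add: bij_betw_same_card)
  then show ?thesis using card_PiE[OF A(1), of "\<lambda>_. carrier K"] dim_basis[OF A] by simp
qed

lemma card_subspace:
  assumes "finite (carrier K)" "finite (carrier V)" and W: "VectorSpace.subspace K W V"
  shows "card W = card (carrier K) ^ vectorspace.dim K (V\<lparr>carrier := W\<rparr>)"
proof -
  have "W \<subseteq> carrier V" using W by (simp add: VectorSpace.subspace_def submodule_def)
  then show ?thesis
    using vectorspace.card_eq_dim[OF subspace_is_vs[OF W]] assms finite_subset by auto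
qed

lemma subspace_iff_submodule: "VectorSpace.subspace K W V \<longleftrightarrow> submodule K W V"
  using vectorspace_axioms by (simp add: VectorSpace.subspace_def)

lemma subspaceD:
  assumes "VectorSpace.subspace K W V"
  shows "W \<subseteq> carrier V" "\<zero>\<^bsub>V\<^esub> \<in> W" "x \<in> W \<Longrightarrow> y \<in> W \<Longrightarrow> x \<oplus>\<^bsub>V\<^esub> y \<in> W"
    "c \<in> carrier K \<Longrightarrow> x \<in> W \<Longrightarrow> c \<odot>\<^bsub>V\<^esub> x \<in> W" "x \<in> W \<Longrightarrow> y \<in> W \<Longrightarrow> x \<ominus>\<^bsub>V\<^esub> y \<in> W"
proof -
  interpret W: submodule K W V using assms by simp
  show sub: "W \<subseteq> carrier V" and "\<zero>\<^bsub>V\<^esub> \<in> W" and add: "x \<in> W \<Longrightarrow> y \<in> W \<Longrightarrow> x \<oplus>\<^bsub>V\<^esub> y \<in> W" for x y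
    using W.subset by auto
  show smult: "c \<in> carrier K \<Longrightarrow> x \<in> W \<Longrightarrow> c \<odot>\<^bsub>V\<^esub> x \<in> W" for c x by simp
  show "x \<ominus>\<^bsub>V\<^esub> y \<in> W" if "x \<in> W" "y \<in> W"
  proof -
    have "\<ominus>\<^bsub>V\<^esub> y = (\<ominus>\<^bsub>K\<^esub> \<one>\<^bsub>K\<^esub>) \<odot>\<^bsub>V\<^esub> y" using smult_minus_1[of y] that(2) sub by auto
    then have "\<ominus>\<^bsub>V\<^esub> y \<in> W" using smult that(2) by simp
    then show ?thesis using add that(1) by (simp add: a_minus_def)
  qed
qed

lemma subspaceI:
  assumes "W \<subseteq> carrier V" "\<zero>\<^bsub>V\<^esub> \<in> W" "\<And>x y. x \<in> W \<Longrightarrow> y \<in> W \<Longrightarrow> x \<oplus>\<^bsub>V\<^esub> y \<in> W"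
    "\<And>c x. c \<in> carrier K \<Longrightarrow> x \<in> W \<Longrightarrow> c \<odot>\<^bsub>V\<^esub> x \<in> W"
  shows "VectorSpace.subspace K W V"
  unfolding subspace_iff_submodule submodule_def using assms module_axioms by simp

text \<open>
  \<open>Y = K v + X\<close>.  The pairs of a scalar and an element of \<open>X\<close> parametrise it without repetition, since
  otherwise a nonzero multiple of \<open>v\<close>, hence \<open>v\<close> itself, would lie in \<open>X\<close>.
\<close>

lemma subspace_add_point:
  assumes X: "VectorSpace.subspace K X V" and Z: "VectorSpace.subspace K Z V" and XZ: "X \<subseteq> Z"
    and v: "v \<in> Z" "v \<notin> X"
  shows "\<exists>Y. VectorSpace.subspace K Y V \<and> insert v X \<subseteq> Y \<and> Y \<subseteq> Z \<and>
    card Y = card (carrier K) * card X"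
proof -
  let ?f = "\<lambda>(c, x). c \<odot>\<^bsub>V\<^esub> v \<oplus>\<^bsub>V\<^esub> x"
  let ?Y = "?f ` (carrier K \<times> X)"
  have vV: "v \<in> carrier V" using subspaceD(1)[OF Z] v by blast
  have XV: "x \<in> carrier V" if "x \<in> X" for x using subspaceD(1)[OF X] that by blast
  have YI: "c \<odot>\<^bsub>V\<^esub> v \<oplus>\<^bsub>V\<^esub> x \<in> ?Y" if "c \<in> carrier K" "x \<in> X" for c x using that by force
  have "VectorSpace.subspace K ?Y V"
  proof (rule subspaceI)
    show "?Y \<subseteq> carrier V" using vV XV by auto
    have "\<zero>\<^bsub>V\<^esub> = \<zero>\<^bsub>K\<^esub> \<odot>\<^bsub>V\<^esub> v \<oplus>\<^bsub>V\<^esub> \<zero>\<^bsub>V\<^esub>" using vV by simp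
    then show "\<zero>\<^bsub>V\<^esub> \<in> ?Y" using YI[of "\<zero>\<^bsub>K\<^esub>" "\<zero>\<^bsub>V\<^esub>"] subspaceD(2)[OF X] by simp
  next
    fix y y' assume "y \<in> ?Y" "y' \<in> ?Y"
    then obtain c x c' x' where y: "c \<in> carrier K" "x \<in> X" "y = c \<odot>\<^bsub>V\<^esub> v \<oplus>\<^bsub>V\<^esub> x"
      and y': "c' \<in> carrier K" "x' \<in> X" "y' = c' \<odot>\<^bsub>V\<^esub> v \<oplus>\<^bsub>V\<^esub> x'" by auto
    have "y \<oplus>\<^bsub>V\<^esub> y' = (c \<oplus>\<^bsub>K\<^esub> c') \<odot>\<^bsub>V\<^esub> v \<oplus>\<^bsub>V\<^esub> (x \<oplus>\<^bsub>V\<^esub> x')"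
      using y y' vV XV by (simp add: smult_l_distr M.a_ac)
    then show "y \<oplus>\<^bsub>V\<^esub> y' \<in> ?Y" using YI[of "c \<oplus>\<^bsub>K\<^esub> c'" "x \<oplus>\<^bsub>V\<^esub> x'"] y y' subspaceD(3)[OF X] by simp
  next
    fix d y assume d: "d \<in> carrier K" and "y \<in> ?Y"
    then obtain c x where y: "c \<in> carrier K" "x \<in> X" "y = c \<odot>\<^bsub>V\<^esub> v \<oplus>\<^bsub>V\<^esub> x" by auto
    have "d \<odot>\<^bsub>V\<^esub> y = (d \<otimes>\<^bsub>K\<^esub> c) \<odot>\<^bsub>V\<^esub> v \<oplus>\<^bsub>V\<^esub> d \<odot>\<^bsub>V\<^esub> x"
      using y d vV XV by (simp add: smult_r_distr smult_assoc1)
    then show "d \<odot>\<^bsub>V\<^esub> y \<in> ?Y" using YI[of "d \<otimes>\<^bsub>K\<^esub> c" "d \<odot>\<^bsub>V\<^esub> x"] d y subspaceD(4)[OF X] by simp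
  qed
  moreover have "v \<in> ?Y"
    using YI[of "\<one>\<^bsub>K\<^esub>" "\<zero>\<^bsub>V\<^esub>"] subspaceD(2)[OF X] vV by simp
  moreover have "X \<subseteq> ?Y"
  proof
    fix x assume "x \<in> X"
    then show "x \<in> ?Y" using YI[of "\<zero>\<^bsub>K\<^esub>" x] vV XV by simp
  qed
  moreover have "?Y \<subseteq> Z" using XZ v(1) subspaceD(3,4)[OF Z] by auto
  moreover have "inj_on ?f (carrier K \<times> X)"
  proof (rule inj_onI, clarify)
    fix c x c' x' assume c: "c \<in> carrier K" "c' \<in> carrier K" and x: "x \<in> X" "x' \<in> X"
      and eq: "c \<odot>\<^bsub>V\<^esub> v \<oplus>\<^bsub>V\<^esub> x = c' \<odot>\<^bsub>V\<^esub> v \<oplus>\<^bsub>V\<^esub> x'"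
    let ?d = "c \<ominus>\<^bsub>K\<^esub> c'"
    have d: "?d \<in> carrier K" using c by simp
    have "c = ?d \<oplus>\<^bsub>K\<^esub> c'" using c by (simp add: a_minus_def R.a_assoc R.l_neg)
    then have "c \<odot>\<^bsub>V\<^esub> v = ?d \<odot>\<^bsub>V\<^esub> v \<oplus>\<^bsub>V\<^esub> c' \<odot>\<^bsub>V\<^esub> v" using smult_l_distr[OF d c(2) vV] by simp
    then have "c' \<odot>\<^bsub>V\<^esub> v \<oplus>\<^bsub>V\<^esub> (?d \<odot>\<^bsub>V\<^esub> v \<oplus>\<^bsub>V\<^esub> x) = c' \<odot>\<^bsub>V\<^esub> v \<oplus>\<^bsub>V\<^esub> x'"
      using eq c d vV XV[OF x(1)] by (simp add: M.a_ac)
    then have dx: "?d \<odot>\<^bsub>V\<^esub> v \<oplus>\<^bsub>V\<^esub> x = x'"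
      using c d vV XV[OF x(1)] XV[OF x(2)] by simp
    have dX: "?d \<odot>\<^bsub>V\<^esub> v \<in> X"
    proof -
      have "?d \<odot>\<^bsub>V\<^esub> v = x' \<ominus>\<^bsub>V\<^esub> x"
        unfolding dx[symmetric] using d vV XV[OF x(1)] by (simp add: a_minus_def M.a_assoc M.r_neg)
      then show ?thesis using subspaceD(5)[OF X x(2,1)] by simp
    qed
    have d0: "?d = \<zero>\<^bsub>K\<^esub>"
    proof (rule ccontr)
      assume "?d \<noteq> \<zero>\<^bsub>K\<^esub>"
      then have "v = inv\<^bsub>K\<^esub> ?d \<odot>\<^bsub>V\<^esub> (?d \<odot>\<^bsub>V\<^esub> v)" "inv\<^bsub>K\<^esub> ?d \<in> carrier K"
        using mult_inverse[OF d vV refl] d field_Units by auto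
      then show False using subspaceD(4)[OF X _ dX] v(2) by metis
    qed
    then have "c = c'" using c by simp
    moreover have "x = x'" using dx d0 vV XV[OF x(1)] by simp
    ultimately show "c = c' \<and> x = x'" by simp
  qed
  then have "card ?Y = card (carrier K) * card X" by (simp add: card_image card_cartesian_product)
  ultimately show ?thesis by blast
qed

text \<open>
  Addition maps \<open>X \<times> Y\<close> to \<open>V\<close>, and two pairs in the same fibre differ by an element of \<open>X \<inter> Y\<close>.
\<close>

lemma card_Int_subspace_ge:
  assumes fin: "finite (carrier V)" and X: "VectorSpace.subspace K X V" and Y: "VectorSpace.subspace K Y V"
  shows "card X * card Y \<le> card (carrier V) * card (X \<inter> Y)"
proof -
  have XV: "X \<subseteq> carrier V" and YV: "Y \<subseteq> carrier V" using subspaceD(1) X Y by blast+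
  have finX: "finite X" "finite Y" using XV YV fin finite_subset by blast+
  let ?F = "\<lambda>v. {p \<in> X \<times> Y. fst p \<oplus>\<^bsub>V\<^esub> snd p = v}"
  have fibre: "card (?F v) \<le> card (X \<inter> Y)" for v
  proof (cases "?F v = {}")
    case True
    show ?thesis unfolding True by simp
  next
    case False
    then obtain x0 y0 where p0: "x0 \<in> X" "y0 \<in> Y" "x0 \<oplus>\<^bsub>V\<^esub> y0 = v" by auto
    have key: "x \<ominus>\<^bsub>V\<^esub> x0 = y0 \<ominus>\<^bsub>V\<^esub> y" if p: "x \<in> X" "y \<in> Y" "x \<oplus>\<^bsub>V\<^esub> y = v" for x y
    proof -
      have C: "x \<in> carrier V" "y \<in> carrier V" "x0 \<in> carrier V" "y0 \<in> carrier V"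
        using p p0 XV YV by auto
      have vV: "v \<in> carrier V" using C p(3) M.a_closed by metis
      have "x \<ominus>\<^bsub>V\<^esub> x0 = (x \<oplus>\<^bsub>V\<^esub> y) \<ominus>\<^bsub>V\<^esub> y \<ominus>\<^bsub>V\<^esub> x0"
        using C by (simp add: a_minus_def M.a_assoc M.r_neg)
      also have "\<dots> = v \<ominus>\<^bsub>V\<^esub> x0 \<ominus>\<^bsub>V\<^esub> y"
        unfolding p(3) using C vV by (simp add: a_minus_def M.a_ac)
      also have "v = y0 \<oplus>\<^bsub>V\<^esub> x0" unfolding p0(3)[symmetric] using C by (simp add: M.a_comm)
      also have "(y0 \<oplus>\<^bsub>V\<^esub> x0) \<ominus>\<^bsub>V\<^esub> x0 \<ominus>\<^bsub>V\<^esub> y = y0 \<ominus>\<^bsub>V\<^esub> y" using C by (simp add: a_minus_def M.a_assoc M.r_neg)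
      finally show ?thesis .
    qed
    have "(\<lambda>p. fst p \<ominus>\<^bsub>V\<^esub> x0) ` ?F v \<subseteq> X \<inter> Y"
    proof
      fix z assume "z \<in> (\<lambda>p. fst p \<ominus>\<^bsub>V\<^esub> x0) ` ?F v"
      then obtain x y where p: "x \<in> X" "y \<in> Y" "x \<oplus>\<^bsub>V\<^esub> y = v" "z = x \<ominus>\<^bsub>V\<^esub> x0" by auto
      then show "z \<in> X \<inter> Y"
        using key[OF p(1-3)] subspaceD(5)[OF X p(1) p0(1)] subspaceD(5)[OF Y p0(2) p(2)] by simp
    qed
    moreover have "inj_on (\<lambda>p. fst p \<ominus>\<^bsub>V\<^esub> x0) (?F v)"
    proof (rule inj_onI)
      fix p p' assume p: "p \<in> ?F v" "p' \<in> ?F v" and eq: "fst p \<ominus>\<^bsub>V\<^esub> x0 = fst p' \<ominus>\<^bsub>V\<^esub> x0"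
      have C: "fst p \<in> carrier V" "fst p' \<in> carrier V" "snd p \<in> carrier V" "snd p' \<in> carrier V" "x0 \<in> carrier V"
        using p p0 XV YV by auto
      have 1: "fst p = fst p'" using eq C by (simp add: a_minus_def)
      then have "fst p \<oplus>\<^bsub>V\<^esub> snd p = fst p \<oplus>\<^bsub>V\<^esub> snd p'" using p by simp
      then have "snd p = snd p'" using C by simp
      then show "p = p'" using 1 by (simp add: prod_eq_iff)
    qed
    ultimately show ?thesis using finX card_inj_on_le by blast
  qed
  have "card X * card Y = (\<Sum>p\<in>X \<times> Y. 1)" by (simp add: card_cartesian_product)
  also have "\<dots> = (\<Sum>v\<in>(\<lambda>p. fst p \<oplus>\<^bsub>V\<^esub> snd p) ` (X \<times> Y). \<Sum>p\<in>?F v. 1)"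
    by (rule sum.image_gen) (use finX in simp)
  also have "\<dots> \<le> (\<Sum>v\<in>(\<lambda>p. fst p \<oplus>\<^bsub>V\<^esub> snd p) ` (X \<times> Y). card (X \<inter> Y))"
    using fibre by (intro sum_mono) simp
  also have "\<dots> = card ((\<lambda>p. fst p \<oplus>\<^bsub>V\<^esub> snd p) ` (X \<times> Y)) * card (X \<inter> Y)" by simp
  also have "\<dots> \<le> card (carrier V) * card (X \<inter> Y)"
    using XV YV by (intro mult_le_mono1 card_mono[OF fin]) (auto simp: subset_iff)
  finally show ?thesis .
qed

lemma subspace_system_subspaces:
  assumes fin: "finite (carrier K)" "finite (carrier V)" and card: "card (carrier V) = card (carrier K) ^ n"
  shows "subspace_system {W. VectorSpace.subspace K W V} {\<zero>\<^bsub>V\<^esub>} (carrier V) (card (carrier K)) n"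
proof
  show "2 \<le> card (carrier K)"
    using card_mono[OF fin(1), of "{\<zero>\<^bsub>K\<^esub>, \<one>\<^bsub>K\<^esub>}"] by simp
  show "{\<zero>\<^bsub>V\<^esub>} \<in> {W. VectorSpace.subspace K W V}" by (auto intro: subspaceI)
  show "carrier V \<in> {W. VectorSpace.subspace K W V}" by (auto intro: subspaceI)
  fix X assume "X \<in> {W. VectorSpace.subspace K W V}"
  then have X: "VectorSpace.subspace K X V" by simp
  show "{\<zero>\<^bsub>V\<^esub>} \<subseteq> X" "X \<subseteq> carrier V" using subspaceD(1,2)[OF X] by auto
  fix Y assume "Y \<in> {W. VectorSpace.subspace K W V}"
  then have Y: "VectorSpace.subspace K Y V" by simp
  have "VectorSpace.subspace K (X \<inter> Y) V"
    using subspaceD[OF X] subspaceD[OF Y] by (intro subspaceI) auto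
  then show "X \<inter> Y \<in> {W. VectorSpace.subspace K W V}" by simp
  show "card X * card Y \<le> card (carrier V) * card (X \<inter> Y)"
    by (rule card_Int_subspace_ge[OF fin(2) X Y])
  show "\<exists>W\<in>{W. VectorSpace.subspace K W V}. insert v X \<subseteq> W \<and> W \<subseteq> Y \<and> card W = card (carrier K) * card X"
    if "X \<subseteq> Y" "v \<in> Y" "v \<notin> X" for v
    using subspace_add_point[OF X Y that] by blast
qed (use assms in auto)

lemma complete_flags_eq:
  assumes fin: "finite (carrier K)" "finite (carrier V)" and card: "card (carrier V) = card (carrier K) ^ n"
  shows "complete_flags K V n =
    subspace_system.flags {W. VectorSpace.subspace K W V} {\<zero>\<^bsub>V\<^esub>} (carrier V) (card (carrier K)) n"
proof -
  interpret S: subspace_system "{W. VectorSpace.subspace K W V}" "{\<zero>\<^bsub>V\<^esub>}" "carrier V" "card (carrier K)" n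
    by (rule subspace_system_subspaces[OF assms])
  have "VectorSpace.subspace K W V \<and> vectorspace.dim K (V\<lparr>carrier := W\<rparr>) = i \<longleftrightarrow> W \<in> S.level i" for W i
    using card_subspace[OF fin, of W] S.pow_inj by (auto simp: S.level_def)
  then show ?thesis unfolding complete_flags_def S.flags_def by simp
qed

end

section \<open>The graph over a finite field\<close>

text \<open>
  Interleaving the odd and the even part of a flag gives the flag back, so a common compatible odd flag is
  the same as a pair of completions with equal odd parts.
\<close>

lemma H_eq_linked_graph:
  fixes K :: "('a, 'm) ring_scheme" and k :: nat
  assumes K: "field K" "finite (carrier K)"
  defines "V \<equiv> coord_space K (2 * k + 1)"
  defines "L \<equiv> {W. VectorSpace.subspace K W V}"
  shows "odd_subspace_system L {\<zero>\<^bsub>V\<^esub>} (carrier V) (card (carrier K)) (2 * k + 1) k"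
    and "H k K = odd_subspace_system.linked_graph L {\<zero>\<^bsub>V\<^esub>} (carrier V) (card (carrier K)) (2 * k + 1)"
proof -
  let ?n = "2 * k + 1"
  interpret K: field K by (rule K(1))
  have carrier: "carrier V = {..<?n} \<rightarrow>\<^sub>E carrier K"
    unfolding V_def by (simp add: K.func_space_def)
  have fin: "finite (carrier V)" unfolding carrier by (intro finite_PiE) (use K in auto)
  have card: "card (carrier V) = card (carrier K) ^ ?n"
    unfolding carrier by (subst card_PiE) auto
  have "module K V" unfolding V_def by (rule K.func_space_is_module)
  then interpret V: vectorspace K V using K(1) by (simp add: vectorspace_def)
  show sys: "odd_subspace_system L {\<zero>\<^bsub>V\<^esub>} (carrier V) (card (carrier K)) ?n k"
    unfolding odd_subspace_system_def odd_subspace_system_axioms_def L_def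
    using V.subspace_system_subspaces[OF K(2) fin card] by simp
  then interpret S: odd_subspace_system L "{\<zero>\<^bsub>V\<^esub>}" "carrier V" "card (carrier K)" ?n k .
  have flags: "complete_flags K V ?n = S.flags"
    unfolding L_def by (rule V.complete_flags_eq[OF K(2) fin card])
  have even: "P_even K V ?n = S.even_flags"
    unfolding P_even_def S.even_flags_def flags ..
  have inter: "interleave V ?n (restrict F (odd_ranks ?n)) (restrict F (even_ranks ?n)) = F"
    if "F \<in> S.flags" for F
  proof
    fix i
    have "F \<in> extensional {0..?n}" using that unfolding S.flags_def by blast
    then have "F i = undefined" if "\<not> i \<le> ?n" using that by (simp add: extensional_def)
    then show "interleave V ?n (restrict F (odd_ranks ?n)) (restrict F (even_ranks ?n)) i = F i"
      using that S.flag_ends[OF that]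
      by (simp add: interleave_def odd_ranks_def even_ranks_def)
  qed
  have parts: "restrict (interleave V ?n A B) (odd_ranks ?n) = A" "restrict (interleave V ?n A B) (even_ranks ?n) = B"
    if "A \<in> P_odd K V ?n" "B \<in> P_even K V ?n" for A B
    using that unfolding P_odd_def P_even_def
    by (auto simp: interleave_def odd_ranks_def even_ranks_def fun_eq_iff)
  have "(\<exists>A\<in>P_odd K V ?n. compatible K V ?n A B \<and> compatible K V ?n A B') \<longleftrightarrow> S.linked B B'"
    if B: "B \<in> P_even K V ?n" "B' \<in> P_even K V ?n" for B B'
  proof
    assume "\<exists>A\<in>P_odd K V ?n. compatible K V ?n A B \<and> compatible K V ?n A B'"
    then obtain A where A: "A \<in> P_odd K V ?n" "interleave V ?n A B \<in> S.flags" "interleave V ?n A B' \<in> S.flags"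
      unfolding compatible_def flags by blast
    then show "S.linked B B'"
      unfolding S.linked_def using parts[OF A(1) B(1)] parts[OF A(1) B(2)] by metis
  next
    assume "S.linked B B'"
    then obtain F F' where F: "F \<in> S.flags" "F' \<in> S.flags" "restrict F (even_ranks ?n) = B"
      "restrict F' (even_ranks ?n) = B'" "restrict F (odd_ranks ?n) = restrict F' (odd_ranks ?n)"
      unfolding S.linked_def by blast
    let ?A = "restrict F (odd_ranks ?n)"
    have "?A \<in> P_odd K V ?n" unfolding P_odd_def flags using F(1) by blast
    moreover have "interleave V ?n ?A B = F" using inter[OF F(1)] F(3) by simp
    moreover have "interleave V ?n ?A B' = F'" using inter[OF F(2)] F(4,5) by simp
    ultimately show "\<exists>A\<in>P_odd K V ?n. compatible K V ?n A B \<and> compatible K V ?n A B'"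
      unfolding compatible_def flags using F(1,2) by metis
  qed
  then have "{(B, B'). B \<in> P_even K V ?n \<and> B' \<in> P_even K V ?n \<and> B \<noteq> B' \<and>
      (\<exists>A\<in>P_odd K V ?n. compatible K V ?n A B \<and> compatible K V ?n A B')} = {(B, B'). S.linked B B' \<and> B \<noteq> B'}"
    using S.linked_even_flags unfolding even by blast
  then show "H k K = S.linked_graph"
    unfolding H_def Let_def V_def[symmetric] S.linked_graph_def even by simp
qed

section \<open>Asymptotics\<close>

lemma q_int_bounds:
  assumes "j \<ge> 1"
  shows "q ^ (j - 1) \<le> q_int q j" "q_int q j \<le> (q + 1) ^ (j - 1)"
proof -
  show "q ^ (j - 1) \<le> q_int q j"
    unfolding q_int_def using assms by (intro member_le_sum) auto
  show "q_int q j \<le> (q + 1) ^ (j - 1)"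
    using assms
  proof (induction j rule: dec_induct)
    case (step m)
    then obtain i where m: "m = Suc i" by (cases m) auto
    have "q_int q (Suc m) = q_int q m + q ^ i * q" by (simp add: q_int_def m)
    also have "\<dots> \<le> (q + 1) ^ i + (q + 1) ^ i * q"
      using step.IH by (intro add_mono mult_right_mono power_mono) (auto simp: m)
    finally show ?case by (simp add: m algebra_simps)
  qed (simp add: q_int_def)
qed

lemma Suc_asymp_equiv: "(\<lambda>q. real q + 1) \<sim>[at_top] real"
  by real_asymp

text \<open>
  All quantities of the theorem are estimated between the same power of \<open>q\<close> and of \<open>q + 1\<close>.
\<close>

lemma asymp_equiv_between:
  assumes "\<And>q. real q ^ m \<le> f q" "\<And>q. f q \<le> (real q + 1) ^ m"
  shows "f \<sim>[at_top] (\<lambda>q. real q ^ m)"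
proof (rule asymp_equiv_sandwich_real[where l = "\<lambda>q. real q ^ m"])
  show "(\<lambda>q. (real q + 1) ^ m) \<sim>[at_top] (\<lambda>q. real q ^ m)"
    by (intro asymp_equiv_power Suc_asymp_equiv)
qed (use assms in auto)

lemma q_fact_asymp: "(\<lambda>q. real (q_fact q t)) \<sim>[at_top] (\<lambda>q. real q ^ (\<Sum>j=1..t. j - 1))"
proof (induction t)
  case (Suc t)
  have "(\<lambda>q. real (q_int q (Suc t))) \<sim>[at_top] (\<lambda>q. real q ^ t)"
  proof (rule asymp_equiv_between)
    fix q
    show "real q ^ t \<le> real (q_int q (Suc t))"
      using of_nat_mono[OF q_int_bounds(1)[of "Suc t" q], where 'a = real] by simp
    show "real (q_int q (Suc t)) \<le> (real q + 1) ^ t"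
      using of_nat_mono[OF q_int_bounds(2)[of "Suc t" q], where 'a = real] by (simp add: add.commute)
  qed
  from asymp_equiv_mult[OF Suc this] show ?case by (simp add: q_fact_def power_add)
qed (simp add: q_fact_def)

lemma sum_pred_odd: "(\<Sum>j=1..2 * k + 1. j - 1) = 2 * k * k + (k::nat)"
  by (induction k) (simp_all add: algebra_simps)

lemma vertex_count_asymp:
  "(\<lambda>q. real (q_fact q (2 * k + 1)) / (real q + 1) ^ k) \<sim>[at_top] (\<lambda>q. real q ^ (2 * k * k))"
proof -
  have "(\<lambda>q. real (q_fact q (2 * k + 1)) / (real q + 1) ^ k) \<sim>[at_top]
      (\<lambda>q. real q ^ (2 * k * k + k) / real q ^ k)"
    using q_fact_asymp[of "2 * k + 1"] unfolding sum_pred_odd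
    by (intro asymp_equiv_divide asymp_equiv_power Suc_asymp_equiv)
  also have "(\<lambda>q. real q ^ (2 * k * k + k) / real q ^ k) \<sim>[at_top] (\<lambda>q. real q ^ (2 * k * k))"
    by (rule asymp_equiv_refl_ev, rule eventually_mono[OF eventually_gt_at_top[of 0]]) (simp add: power_add)
  finally show ?thesis .
qed

lemma H_degree_bounds:
  assumes "k \<ge> 1"
  shows "real q ^ (2 * k) \<le> real (H_degree k q)" "real (H_degree k q) \<le> K_bound k q"
    "K_bound k q \<le> (real q + 1) ^ (2 * k)"
proof -
  have "real (H_degree k q) \<le> real ((q + 1) ^ k * ((q + 1) ^ k - 1))"
    using H_degree_le[of k q] by (simp only: of_nat_le_iff)
  then show "real (H_degree k q) \<le> K_bound k q"
    by (simp add: K_bound_def of_nat_diff add.commute)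
  have "q ^ (2 * k) \<le> (q + 1) ^ k * q ^ k"
    unfolding mult_2 power_add by (intro mult_right_mono power_mono) auto
  also have "\<dots> \<le> H_degree k q" by (rule H_degree_ge[OF assms])
  finally show "real q ^ (2 * k) \<le> real (H_degree k q)"
    by (metis of_nat_le_iff of_nat_power)
  show "K_bound k q \<le> (real q + 1) ^ (2 * k)"
    unfolding K_bound_def mult_2 power_add by (intro mult_left_mono) auto
qed

lemma H_degree_asymp:
  assumes "k \<ge> 1"
  shows "(\<lambda>q. real (H_degree k q)) \<sim>[at_top] (\<lambda>q. real q ^ (2 * k))"
  using H_degree_bounds[OF assms] by (intro asymp_equiv_between) (blast intro: order_trans)+

lemma K_bound_asymp:
  assumes "k \<ge> 1"
  shows "K_bound k \<sim>[at_top] (\<lambda>q. real q ^ (2 * k))"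
  using H_degree_bounds[OF assms] by (intro asymp_equiv_between) (blast intro: order_trans)+

lemma asymp_equiv_subfilter:
  assumes "f \<sim>[F] g" "G \<le> F"
  shows "f \<sim>[G] g"
  using assms unfolding asymp_equiv_def by (rule filterlim_mono[OF _ order_refl])

theorem proposition3p1:
  fixes k :: nat and \<F> :: "nat \<Rightarrow> 'a ring"
  assumes "k \<ge> 1"
    and "\<And>q. primepow q \<Longrightarrow> field (\<F> q) \<and> card (carrier (\<F> q)) = q"
  shows "\<exists>\<Delta> :: nat \<Rightarrow> nat.
    (\<forall>q. primepow q \<longrightarrow>
       regular_of_degree (H k (\<F> q)) (\<Delta> q) \<and>
       real (card (verts (H k (\<F> q)))) = real (q_fact q (2 * k + 1)) / (real q + 1) ^ k \<and>
       real (\<Delta> q) \<le> K_bound k q \<and>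
       diam (H k (\<F> q)) = ereal (real k)) \<and>
    (\<lambda>q. real (\<Delta> q)) \<sim>[inf at_top (principal {q. primepow q})] (\<lambda>q. K_bound k q) \<and>
    (\<lambda>q. real (card (verts (H k (\<F> q)))))
      \<sim>[inf at_top (principal {q. primepow q})] (\<lambda>q. real (\<Delta> q) ^ k)"
proof (intro exI[of _ "H_degree k"] conjI allI impI)
  let ?P = "inf at_top (principal {q. primepow q}) :: nat filter"
  have each: "regular_of_degree (H k (\<F> q)) (H_degree k q) \<and>
      real (card (verts (H k (\<F> q)))) = real (q_fact q (2 * k + 1)) / (real q + 1) ^ k \<and>
      diam (H k (\<F> q)) = ereal (real k)" if q: "primepow q" for q
  proof -
    let ?K = "\<F> q"
    let ?V = "coord_space ?K (2 * k + 1)"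
    have K: "field ?K" "card (carrier ?K) = q" using assms(2)[OF q] by auto
    have "q > 0" using q by (rule primepow_gt_0_nat)
    then have fin: "finite (carrier ?K)" using K(2) by (intro card_ge_0_finite) simp
    interpret G: odd_subspace_system "{W. VectorSpace.subspace ?K W ?V}" "{\<zero>\<^bsub>?V\<^esub>}" "carrier ?V" q "2 * k + 1" k
      using H_eq_linked_graph(1)[OF K(1) fin, of k] unfolding K(2) .
    have H: "H k ?K = G.linked_graph"
      using H_eq_linked_graph(2)[OF K(1) fin, of k] unfolding K(2) .
    have "real (card (verts G.linked_graph)) * (real q + 1) ^ k = real (q_fact q (2 * k + 1))"
      using arg_cong[OF G.card_even_flags, of real]
      unfolding G.linked_graph_simps of_nat_mult of_nat_power of_nat_add of_nat_1 .
    moreover have "(real q + 1) ^ k \<noteq> 0" by (simp add: add_eq_0_iff)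
    ultimately have "real (card (verts G.linked_graph)) = real (q_fact q (2 * k + 1)) / (real q + 1) ^ k"
      by (simp only: eq_divide_eq simp_thms if_True if_False)
    then show ?thesis
      unfolding H using G.regular_linked_graph G.diam_linked_graph[OF assms(1)] by blast
  qed
  show "regular_of_degree (H k (\<F> q)) (H_degree k q)"
    "real (card (verts (H k (\<F> q)))) = real (q_fact q (2 * k + 1)) / (real q + 1) ^ k"
    "diam (H k (\<F> q)) = ereal (real k)" if "primepow q" for q
    using each[OF that] by blast+
  show "real (H_degree k q) \<le> K_bound k q" for q by (rule H_degree_bounds(2)[OF assms(1)])
  have P: "?P \<le> at_top" by simp
  have "(\<lambda>q. real (H_degree k q)) \<sim>[at_top] K_bound k"
    using asymp_equiv_trans[OF H_degree_asymp[OF assms(1)] asymp_equiv_symI[OF K_bound_asymp[OF assms(1)]]] .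
  then show "(\<lambda>q. real (H_degree k q)) \<sim>[?P] (\<lambda>q. K_bound k q)"
    by (rule asymp_equiv_subfilter[OF _ P])
  have "(\<lambda>q. real (H_degree k q) ^ k) \<sim>[at_top] (\<lambda>q. (real q ^ (2 * k)) ^ k)"
    by (intro asymp_equiv_power H_degree_asymp assms(1))
  then have "(\<lambda>q. real (q_fact q (2 * k + 1)) / (real q + 1) ^ k) \<sim>[at_top] (\<lambda>q. real (H_degree k q) ^ k)"
    using asymp_equiv_trans[OF vertex_count_asymp asymp_equiv_symI] by (simp add: power_mult[symmetric])
  then have "(\<lambda>q. real (q_fact q (2 * k + 1)) / (real q + 1) ^ k) \<sim>[?P] (\<lambda>q. real (H_degree k q) ^ k)"
    by (rule asymp_equiv_subfilter[OF _ P])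
  moreover have "eventually (\<lambda>q. real (card (verts (H k (\<F> q)))) =
      real (q_fact q (2 * k + 1)) / (real q + 1) ^ k) ?P"
    unfolding eventually_inf_principal using each by (intro always_eventually) blast
  ultimately show "(\<lambda>q. real (card (verts (H k (\<F> q))))) \<sim>[?P] (\<lambda>q. real (H_degree k q) ^ k)"
    by (rule asymp_equiv_cong[THEN iffD2, OF _ always_eventually[rule_format, OF refl], rotated])
qed

end
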